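(* Let $n\ge1$ and let $Q_1,\dots,Q_n$ be an arbitrary collection of lattice convex polytopes in $\mathbb R^n$. Let $k$ be a field, $A=k[x_0,x_1,\dots,x_n]$, and let $\mathfrak m$ be the maximal graded ideal of $A$. For each $i=1,\dots,n$ let $M_i$ be any finite set of monomials of the same degree in $A$ such that $Q_i$ is the convex hull of the lattice points of their dehomogenized monomials in $k[x_1,\dots,x_n]$. Let $J_i$ be the ideal of $A$ generated by the monomials of $M_i$. Then $$MV_n(Q_1,\dots,Q_n)=e_{(0,1,\dots,1)}(\mathfrak m|J_1,\dots,J_n).$$
   Context: The common degree of the monomials in $M_i$ may depend on $i$. The lattice point of a monomial $x_1^{a_1}\cdots x_n^{a_n}$ is $(a_1,\dots,a_n)$; the dehomogenization of $x_0^{a_0}x_1^{a_1}\cdots x_n^{a_n}$ is $x_1^{a_1}\cdots x_n^{a_n}$ (set $x_0=1$). Mixed volume: with $P+Q=\{a+b\mid a\in P,b\in Q\}$ the Minkowski sum and $V_n$ the $n$-dimensional Euclidean volume, $$MV_n(Q_1,\dots,Q_n):=\sum_{h=1}^n\ \sum_{1\le i_1<\cdots<i_h\le n}(-1)^{n-h}V_n(Q_{i_1}+\cdots+Q_{i_h}).$$ Mixed multiplicities: let $R=R(\mathfrak m|J_1,\dots,J_n):=\bigoplus_{u\in\mathbb N^{n+1}}\mathfrak m^{u_0}J_1^{u_1}\cdots J_n^{u_n}/\mathfrak m^{u_0+1}J_1^{u_1}\cdots J_n^{u_n}$. There is a polynomial $P_R(u)$ with $\ell(R_u)=P_R(u)$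 whenever all $u_i$ are sufficiently large. In the present situation $\deg P_R=n$; write $P_R(u)=\sum_{\alpha\in\mathbb N^{n+1},|\alpha|=n}\frac1{\alpha!}e_\alpha u^\alpha+\{\text{terms of degree}<n\}$, where $|\alpha|=\alpha_0+\cdots+\alpha_n$, $\alpha!=\alpha_0!\cdots\alpha_n!$, $u^\alpha=u_0^{\alpha_0}\cdots u_n^{\alpha_n}$, and set $e_\alpha(\mathfrak m|J_1,\dots,J_n):=e_\alpha$. *)

theory Defs
  imports
    "HOL-Analysis.Analysis"
    "HOL-Library.Poly_Mapping"
    "HOL-Library.Set_Algebras"
    "HOL-Library.Extended_Real"
begin

(* For a finite index type 'n with n elements, the type 'n option has n + 1 elements:
   None is the index 0, and Some i runs through the indices 1, ..., n. *)

(* A monomial is represented by its exponent vector. With the convolution product of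
   Poly_Mapping, ('v, 'k) mpoly is the polynomial ring over 'k in the variables 'v. *)
type_synonym 'v monomial = "'v \<Rightarrow>\<^sub>0 nat"
type_synonym ('v, 'k) mpoly = "'v monomial \<Rightarrow>\<^sub>0 'k"

definition poly_of_monomial :: "'v monomial \<Rightarrow> ('v, 'k::comm_ring_1) mpoly" where
  "poly_of_monomial a = Poly_Mapping.single a 1"

definition mon_degree :: "'v::finite monomial \<Rightarrow> nat" where
  "mon_degree a = (\<Sum>v\<in>UNIV. Poly_Mapping.lookup a v)"

definition mpoly_eval :: "('v::finite, 'r::comm_ring_1) mpoly \<Rightarrow> ('v \<Rightarrow> 'r) \<Rightarrow> 'r" where
  "mpoly_eval P x = (\<Sum>a\<in>Poly_Mapping.keys P.
     Poly_Mapping.lookup P a * (\<Prod>v\<in>UNIV. x v ^ Poly_Mapping.lookup a v))"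

definition dehomogenize :: "'n option monomial \<Rightarrow> 'n monomial" where
  "dehomogenize a = Poly_Mapping.map_key Some a"

definition lattice_point :: "'n::finite monomial \<Rightarrow> real ^ 'n" where
  "lattice_point a = (\<chi> i. real (Poly_Mapping.lookup a i))"

(* The finite set S is required to be non-empty: the empty set is not a polytope here. *)
definition lattice_polytope :: "(real ^ 'n) set \<Rightarrow> bool" where
  "lattice_polytope P \<longleftrightarrow>
     (\<exists>S. finite S \<and> S \<noteq> {} \<and> (\<forall>x\<in>S. \<forall>i. x $ i \<in> \<int>) \<and> P = convex hull S)"

(* The inner sum over i in H is the Minkowski sum (pointwise addition of sets). *)
definition mixed_volume :: "('n::finite \<Rightarrow> (real ^ 'n) set) \<Rightarrow> real" where
  "mixed_volume Q =
     (\<Sum>h = 1..CARD('n). \<Sum>H | card H = h.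
        (-1) ^ (CARD('n) - h) * measure lebesgue (\<Sum>i\<in>H. Q i))"

abbreviation ideal_gen :: "'a::comm_ring_1 set \<Rightarrow> 'a set" where
  "ideal_gen \<equiv> module.span (*)"

definition max_graded_ideal :: "('v, 'k::comm_ring_1) mpoly set" where
  "max_graded_ideal = ideal_gen {poly_of_monomial (Poly_Mapping.single v 1) | v. True}"

(* N / L for ideals L \<subseteq> N, as a set of cosets. *)
definition quotient_module :: "'a::comm_ring_1 set \<Rightarrow> 'a set \<Rightarrow> 'a set set" where
  "quotient_module N L = (\<lambda>x. x +o L) ` N"

(* Submodules of N / L over the whole ring; X + Y is the sum of cosets, and L is the zero. *)
definition quotient_submodule :: "'a::comm_ring_1 set \<Rightarrow> 'a set \<Rightarrow> 'a set set \<Rightarrow> bool" where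
  "quotient_submodule N L S \<longleftrightarrow>
     S \<subseteq> quotient_module N L \<and> L \<in> S \<and>
     (\<forall>X\<in>S. \<forall>Y\<in>S. X + Y \<in> S) \<and>
     (\<forall>a x. x +o L \<in> S \<longrightarrow> (a * x) +o L \<in> S)"

definition quotient_length :: "'a::comm_ring_1 set \<Rightarrow> 'a set \<Rightarrow> enat" where
  "quotient_length N L = Sup {enat r | r. \<exists>c :: nat \<Rightarrow> 'a set set.
     (\<forall>i\<le>r. quotient_submodule N L (c i)) \<and> (\<forall>i<r. c i \<subset> c (Suc i))}"

(* The ideal m^(u_0) J_1^(u_1) ... J_n^(u_n). The powers and products under ideal_gen are
   elementwise ones of sets, so it is generated by all products of elements of the factors;
   a zeroth power is {1}, which generates the unit ideal. *)
definition ideal_power_product ::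
    "'a::comm_ring_1 set \<Rightarrow> ('n::finite \<Rightarrow> 'a set) \<Rightarrow> ('n option \<Rightarrow> nat) \<Rightarrow> 'a set" where
  "ideal_power_product m J u = ideal_gen (m ^ u None * (\<Prod>i\<in>UNIV. J i ^ u (Some i)))"

(* The length of the component R_u of R(m | J_1, ..., J_n). The ring acts on R_u through
   its surjection onto R_0, so submodules over either ring are the same. *)
definition mixed_length ::
    "'a::comm_ring_1 set \<Rightarrow> ('n::finite \<Rightarrow> 'a set) \<Rightarrow> ('n option \<Rightarrow> nat) \<Rightarrow> enat" where
  "mixed_length m J u =
     quotient_length (ideal_power_product m J u)
       (ideal_power_product m J (u(None := u None + 1)))"

(* The polynomial is unique if it exists, being determined by its values at large u. *)
definition mixed_hilbert_poly ::
    "'a::comm_ring_1 set \<Rightarrow> ('n::finite \<Rightarrow> 'a set) \<Rightarrow> ('n option, real) mpoly" where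
  "mixed_hilbert_poly m J = (THE P. \<exists>N. \<forall>u. (\<forall>v. N \<le> u v) \<longrightarrow>
     ereal_of_enat (mixed_length m J u) = ereal (mpoly_eval P (\<lambda>v. real (u v))))"

(* This is the mixed multiplicity only for exponents \<alpha> whose total |\<alpha>| is the degree of the
   polynomial; there e_\<alpha> / \<alpha>! is the coefficient at u^\<alpha>. *)
definition mixed_multiplicity ::
    "('n::finite option \<Rightarrow> nat) \<Rightarrow> 'a::comm_ring_1 set \<Rightarrow> ('n \<Rightarrow> 'a set) \<Rightarrow> real" where
  "mixed_multiplicity \<alpha> m J =
     (\<Prod>v\<in>UNIV. fact (\<alpha> v)) * Poly_Mapping.lookup (mixed_hilbert_poly m J) (Abs_poly_mapping \<alpha>)"

end

(* All ideals involved are monomial, and m^u0 J^u is generated in a single degree, so R_u has as a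
   k-basis the monomials of that degree; its length is the number of points of the sumset
   B_u = u_0 D + u_1 A_1 + ... + u_n A_n in Z^n, where D consists of 0 and the unit vectors and A_i of
   the dehomogenized points of M_i. By Khovanskii's theorem (in the style of Nathanson and Ruzsa) this
   number is a polynomial P(u) for large u. For u >= 1 the set B_u contains a translate of D, hence
   |t B_u| ~ t^n V(conv B_u), and so the degree-n part of P at u is the volume of
   u_0 conv D + u_1 Q_1 + ... + u_n Q_n. By continuity this extends to u = (0, 1_H), and
   inclusion-exclusion over H leaves exactly the coefficient of u_1 ... u_n. *)

theory Submission
  imports Defs "HOL-Library.Multiset_Order" "HOL-Computational_Algebra.Polynomial"
begin

subsection \<open>Dickson's lemma\<close>

text \<open>The obstacle is that counting points measures volume only in part. If the differences of
  a set B in Z^n generate a sublattice of index greater than 1, then |t B| grows like the volume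
  divided by that index. The factor m cures this: every \<open>u\<close> with a positive entry at
  \<open>None\<close> puts a whole unit simplex into the sumset. The wanted coefficient, however, is
  read off on the face u_0 = 0, where no simplex is present. Hence counts are abandoned before the
  face is reached: they are replaced by the degree-n part of P, a homogeneous function of real
  arguments, which is continuous up to the face just as the volume is. Polytopes Q_i of lower
  dimension are covered by the same argument. No bound on the degree of P is established beforehand;
  convergence of P(t u) / t^n determines the coefficient of t^n by itself.\<close>

lemma nat_sequence_mono_subsequence:
  fixes f :: "nat \<Rightarrow> nat"
  shows "\<exists>g :: nat \<Rightarrow> nat. strict_mono g \<and> mono (f \<circ> g)"
proof -
  obtain g :: "nat \<Rightarrow> nat" where g: "strict_mono g" "monoseq (\<lambda>n. f (g n))"
    using seq_monosub by blast
  show ?thesis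
  proof (cases "incseq (\<lambda>n. f (g n))")
    case True
    then show ?thesis using g by (auto simp: o_def)
  next
    case False
    then have dec: "decseq (\<lambda>n. f (g n))" using g by (simp add: monoseq_iff)
    define m where "m = (LEAST k. k \<in> range (\<lambda>n. f (g n)))"
    have "m \<in> range (\<lambda>n. f (g n))" unfolding m_def by (rule LeastI) blast
    then obtain n0 where n0: "f (g n0) = m" by auto
    \<comment> \<open>A decreasing sequence of naturals stays constant once it has reached its
      minimum, so its tail is monotone in the required direction as well.\<close>
    have "f (g (n0 + k)) = m" for k
    proof (rule antisym)
      show "f (g (n0 + k)) \<le> m" using decseqD[OF dec, of n0 "n0 + k"] n0 by simp
      show "m \<le> f (g (n0 + k))" unfolding m_def by (rule Least_le) simp
    qed
    then have "mono (f \<circ> (\<lambda>k. g (n0 + k)))" by (simp add: o_def mono_def)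
    moreover have "strict_mono (\<lambda>k. g (n0 + k))"
      using g(1) by (simp add: strict_mono_def)
    ultimately show ?thesis by blast
  qed
qed

lemma dickson_subsequence:
  fixes f :: "nat \<Rightarrow> 'p \<Rightarrow> nat"
  assumes "finite I"
  shows "\<exists>g :: nat \<Rightarrow> nat. strict_mono g \<and> (\<forall>p\<in>I. mono (\<lambda>n. f (g n) p))"
  using assms
proof (induction I)
  case empty
  then show ?case using strict_mono_id by auto
next
  case (insert q I)
  then obtain g :: "nat \<Rightarrow> nat" where g: "strict_mono g" "\<And>p. p \<in> I \<Longrightarrow> mono (\<lambda>n. f (g n) p)"
    by blast
  obtain h :: "nat \<Rightarrow> nat" where h: "strict_mono h" "mono ((\<lambda>n. f (g n) q) \<circ> h)"
    using nat_sequence_mono_subsequence by blast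
  have "mono (\<lambda>n. f (g (h n)) p)" if "p \<in> I" for p
    using g(2)[OF that] strict_mono_mono[OF h(1)] by (auto simp: mono_def)
  then show ?case using h(2) strict_mono_o[OF g(1) h(1)]
    by (intro exI[of _ "g \<circ> h"]) (auto simp: o_def)
qed

text \<open>Multisets over the finite set \<open>I\<close> are exponent vectors, and
  \<open>\<subseteq>#\<close> is divisibility of monomials. The minimal elements of \<open>W\<close>
  form an antichain; an infinite antichain would contradict the coordinatewise monotone subsequence.
  Descent on the size finds a minimal element below each \<open>w\<close>.\<close>

theorem dickson:
  fixes W :: "'p multiset set"
  assumes I: "finite I" and W: "\<And>w. w \<in> W \<Longrightarrow> set_mset w \<subseteq> I"
  obtains F where "finite F" "F \<subseteq> W" "\<And>w. w \<in> W \<Longrightarrow> \<exists>f\<in>F. f \<subseteq># w"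
proof
  define F where "F = {w \<in> W. \<forall>w'\<in>W. w' \<subseteq># w \<longrightarrow> w' = w}"
  show "F \<subseteq> W" by (auto simp: F_def)
  show "finite F"
  proof (rule ccontr)
    assume "infinite F"
    then obtain f :: "nat \<Rightarrow> 'p multiset" where f: "inj f" "range f \<subseteq> F"
      using infinite_countable_subset by blast
    obtain g :: "nat \<Rightarrow> nat"
      where g: "strict_mono g" "\<And>p. p \<in> I \<Longrightarrow> mono (\<lambda>n. count (f (g n)) p)"
      using dickson_subsequence[OF I, of "\<lambda>n. count (f n)"] by blast
    have FW: "f n \<in> F" "f n \<in> W" for n using f(2) \<open>F \<subseteq> W\<close> by auto
    have "count (f (g 0)) p \<le> count (f (g 1)) p" for p
    proof (cases "p \<in> I")
      case True
      then show ?thesis using g(2)[of p] by (auto simp: mono_def)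
    next
      case False
      then have "p \<notin># f (g 0)" using W[OF FW(2)] by blast
      then have "count (f (g 0)) p = 0" by (simp only: count_eq_zero_iff not_False_eq_True)
      then show ?thesis by simp
    qed
    then have "f (g 0) \<subseteq># f (g 1)" by (simp add: subseteq_mset_def)
    then have "f (g 0) = f (g 1)" using FW(1)[of "g 1"] FW(2)[of "g 0"] by (auto simp: F_def)
    then have "g 0 = g 1" using f(1) by (simp add: inj_eq)
    then show False using strict_mono_less[OF g(1), of 0 1] by simp
  qed
  show "\<exists>f\<in>F. f \<subseteq># w" if "w \<in> W" for w
    using that
  proof (induction "size w" arbitrary: w rule: less_induct)
    case less
    show ?case
    proof (cases "w \<in> F")
      case False
      then obtain v where v: "v \<in> W" "v \<subseteq># w" "v \<noteq> w" using less.prems by (auto simp: F_def)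
      then have "size v < size w" by (simp add: mset_subset_size subset_mset.less_le)
      from less.hyps[OF this v(1)] show ?thesis using v(2) by (meson subset_mset.order_trans)
    qed auto
  qed
qed

subsection \<open>Polynomial growth of sumsets\<close>

text \<open>The only products built in are those with a variable. This keeps the induction in
  \<open>polyfun_is_mpoly\<close> down to a shift of exponents; closure under all products is
  derived.\<close>

inductive_set polyfuns :: "(('v \<Rightarrow> real) \<Rightarrow> real) set" where
  const: "(\<lambda>_. c) \<in> polyfuns"
| add: "f \<in> polyfuns \<Longrightarrow> g \<in> polyfuns \<Longrightarrow> (\<lambda>x. f x + g x) \<in> polyfuns"
| var_mult: "f \<in> polyfuns \<Longrightarrow> (\<lambda>x. x v * f x) \<in> polyfuns"

lemma polyfuns_mult:
  assumes "f \<in> polyfuns" "g \<in> polyfuns"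
  shows "(\<lambda>x. f x * g x) \<in> polyfuns"
  using assms(1)
proof induction
  case (const c)
  show ?case using assms(2)
  proof induction
    case (const d) show ?case by (rule polyfuns.const)
  next
    case (add f g) from polyfuns.add[OF add.IH] show ?case by (simp add: algebra_simps)
  next
    case (var_mult f v) from polyfuns.var_mult[OF var_mult.IH, of v] show ?case by (simp add: algebra_simps)
  qed
next
  case (add f g) from polyfuns.add[OF add.IH] show ?case by (simp add: algebra_simps)
next
  case (var_mult f v) from polyfuns.var_mult[OF var_mult.IH, of v] show ?case by (simp add: algebra_simps)
qed

lemma polyfuns_diff:
  assumes "f \<in> polyfuns" "g \<in> polyfuns"
  shows "(\<lambda>x. f x - g x) \<in> polyfuns"
  using polyfuns.add[OF assms(1) polyfuns_mult[OF polyfuns.const[of "-1"] assms(2)]] by simp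

lemma polyfuns_prod:
  assumes "\<And>i. i \<in> I \<Longrightarrow> f i \<in> polyfuns"
  shows "(\<lambda>x. \<Prod>i\<in>I. f i x) \<in> polyfuns"
  using assms
  by (induction I rule: infinite_finite_induct) (auto intro: polyfuns.const polyfuns_mult)

lemma polyfuns_gbinomial: "(\<lambda>x. (x v + c) gchoose k) \<in> polyfuns"
proof -
  have "(\<lambda>x. x v + d) \<in> polyfuns" for d
    using polyfuns.add[OF polyfuns.var_mult[OF polyfuns.const[of 1], of v] polyfuns.const[of d]]
    by simp
  from polyfuns_mult[OF polyfuns_prod[of "{0..<k}" "\<lambda>i x. x v + (c - real i)", OF this]
      polyfuns.const[of "inverse (fact k)"]]
  show ?thesis by (simp add: gbinomial_prod_rev divide_inverse add_diff_eq)
qed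

definition eventually_poly :: "(('v \<Rightarrow> nat) \<Rightarrow> real) \<Rightarrow> bool" where
  "eventually_poly f \<longleftrightarrow>
     (\<exists>p\<in>polyfuns. \<exists>N. \<forall>u. (\<forall>v. N \<le> u v) \<longrightarrow> f u = p (\<lambda>v. real (u v)))"

lemma eventually_poly_combine:
  fixes f g :: "('v \<Rightarrow> nat) \<Rightarrow> real"
  assumes "eventually_poly f" "eventually_poly g"
    and "\<And>p q. p \<in> polyfuns \<Longrightarrow> q \<in> polyfuns \<Longrightarrow>
      (\<lambda>x :: 'v \<Rightarrow> real. h (p x) (q x)) \<in> polyfuns"
  shows "eventually_poly (\<lambda>u. h (f u) (g u))"
proof -
  obtain p q N M where "p \<in> polyfuns" "q \<in> polyfuns"
    "\<And>u. \<forall>v. N \<le> u v \<Longrightarrow> f u = p (\<lambda>v. real (u v))"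
    "\<And>u. \<forall>v. M \<le> u v \<Longrightarrow> g u = q (\<lambda>v. real (u v))"
    using assms(1,2) unfolding eventually_poly_def by metis
  then show ?thesis unfolding eventually_poly_def
    by (intro bexI[OF _ assms(3)[of p q]] exI[of _ "max N M"]) auto
qed

context
  fixes A :: "'i::finite \<Rightarrow> 'b::comm_monoid_add set"
  assumes fin: "\<And>i. finite (A i)" and ne: "\<And>i. A i \<noteq> {}"
begin

text \<open>A multiset of pairs is a monomial in a polynomial ring with one variable for each pair
  \<open>(i, a)\<close>, \<open>a \<in> A i\<close>. \<open>grade\<close> is its multidegree, and
  \<open>element_sum\<close> is the point of the sumset that it represents.\<close>

definition grade :: "('i \<times> 'b) multiset \<Rightarrow> 'i \<Rightarrow> nat" where
  "grade x i = size (filter_mset (\<lambda>p. fst p = i) x)"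

definition graded_part :: "('i \<Rightarrow> nat) \<Rightarrow> ('i \<times> 'b) multiset set" where
  "graded_part u = {x. set_mset x \<subseteq> Sigma UNIV A \<and> grade x = u}"

definition element_sum :: "('i \<times> 'b) multiset \<Rightarrow> 'b" where
  "element_sum x = sum_mset (image_mset snd x)"

lemma grade_plus: "grade (x + y) = (\<lambda>i. grade x i + grade y i)"
  by (simp add: grade_def fun_eq_iff)

lemma element_sum_plus: "element_sum (x + y) = element_sum x + element_sum y"
  by (simp add: element_sum_def)

lemma sum_filter_fst: "(\<Sum>i\<in>UNIV. filter_mset (\<lambda>p. fst p = i) x) = (x :: ('i \<times> 'b) multiset)"
  by (rule multiset_eqI) (simp add: count_sum cong: if_cong)

lemma element_sum_eq_sum: "element_sum x = (\<Sum>i\<in>UNIV. sum_mset (image_mset snd (filter_mset (\<lambda>p. fst p = i) x)))"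
proof (induction x)
  case empty
  then show ?case by (simp add: element_sum_def)
next
  case (add p x)
  have "(\<Sum>i\<in>UNIV. sum_mset (image_mset snd (filter_mset (\<lambda>q. fst q = i) (add_mset p x))))
      = (\<Sum>i\<in>UNIV. (if fst p = i then snd p else 0)
          + sum_mset (image_mset snd (filter_mset (\<lambda>p. fst p = i) x)))"
    by (rule sum.cong) simp_all
  also have "\<dots> = snd p + element_sum x" by (simp only: sum.distrib add[symmetric]) simp
  also have "\<dots> = element_sum (add_mset p x)" by (simp add: element_sum_def)
  finally show ?case by (rule sym)
qed

lemma filter_fst_sum_Pair:
  "filter_mset (\<lambda>p. fst p = i) (\<Sum>j\<in>UNIV. image_mset (Pair j) (f j)) = image_mset (Pair i) (f i)"
  for f :: "'i \<Rightarrow> 'b multiset"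
proof -
  have "filter_mset (\<lambda>p. fst p = i) (\<Sum>j\<in>UNIV. image_mset (Pair j) (f j))
    = (\<Sum>j\<in>UNIV. filter_mset (\<lambda>p. fst p = i) (image_mset (Pair j) (f j)))"
    by (rule multiset_eqI) (simp add: count_sum)
  also have "\<dots> = (\<Sum>j\<in>UNIV. if j = i then image_mset (Pair i) (f i) else {#})"
    by (rule sum.cong) (simp_all add: filter_mset_image_mset)
  finally show ?thesis by simp
qed

lemma image_Pair_snd_filter:
  "image_mset (Pair i) (image_mset snd (filter_mset (\<lambda>p. fst p = i) x)) = filter_mset (\<lambda>p. fst p = i) x"
  by (induction x) auto

text \<open>Sorting a monomial by first components makes a graded part a product of sets of
  multisets of prescribed sizes, whose cardinalities are known binomial coefficients.\<close>

lemma bij_graded_part: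
  "bij_betw (\<lambda>x i. image_mset snd (filter_mset (\<lambda>p. fst p = i) x)) (graded_part u)
     {f. \<forall>i. f i \<in> multisets_of_size (A i) (u i)}"
proof (rule bij_betwI[where g = "\<lambda>f. \<Sum>i\<in>UNIV. image_mset (Pair i) (f i)"])
  show "(\<lambda>x i. image_mset snd (filter_mset (\<lambda>p. fst p = i) x))
      \<in> graded_part u \<rightarrow> {f. \<forall>i. f i \<in> multisets_of_size (A i) (u i)}"
  proof (intro funcsetI CollectI allI)
    fix x i assume "x \<in> graded_part u"
    then have "set_mset x \<subseteq> Sigma UNIV A" "grade x i = u i" by (auto simp: graded_part_def)
    then show "image_mset snd (filter_mset (\<lambda>p. fst p = i) x) \<in> multisets_of_size (A i) (u i)"
      by (force simp: grade_def multisets_of_size_def)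
  qed
  show "(\<lambda>f. \<Sum>i\<in>UNIV. image_mset (Pair i) (f i))
      \<in> {f. \<forall>i. f i \<in> multisets_of_size (A i) (u i)} \<rightarrow> graded_part u"
  proof (intro funcsetI)
    fix f assume f: "f \<in> {f. \<forall>i. f i \<in> multisets_of_size (A i) (u i)}"
    have "set_mset (\<Sum>i\<in>UNIV. image_mset (Pair i) (f i)) \<subseteq> Sigma UNIV A"
      using f by (auto simp: set_mset_sum multisets_of_size_def)
    then show "(\<Sum>i\<in>UNIV. image_mset (Pair i) (f i)) \<in> graded_part u"
      using f by (simp add: graded_part_def grade_def filter_fst_sum_Pair multisets_of_size_def fun_eq_iff)
  qed
  show "(\<Sum>i\<in>UNIV. image_mset (Pair i) (image_mset snd (filter_mset (\<lambda>p. fst p = i) x))) = x"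
    for x :: "('i \<times> 'b) multiset"
    by (simp only: image_Pair_snd_filter sum_filter_fst)
  show "(\<lambda>i. image_mset snd (filter_mset (\<lambda>p. fst p = i) (\<Sum>i\<in>UNIV. image_mset (Pair i) (f i)))) = f"
    for f :: "'i \<Rightarrow> 'b multiset"
    by (simp add: filter_fst_sum_Pair fun_eq_iff multiset.map_comp o_def)
qed

lemma graded_codomain:
  "{f. \<forall>i. f i \<in> multisets_of_size (A i) (u i)} = PiE UNIV (\<lambda>i. multisets_of_size (A i) (u i))"
  by (auto simp: PiE_def extensional_def)

lemma finite_graded_part: "finite (graded_part u)"
  by (subst bij_betw_finite[OF bij_graded_part], subst graded_codomain)
    (rule finite_PiE[OF finite finite_multisets_of_size[OF fin]])

lemma card_graded_part: "card (graded_part u) = (\<Prod>i\<in>UNIV. (card (A i) + u i - 1) choose u i)"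
proof -
  have "card (graded_part u) = card (PiE UNIV (\<lambda>i. multisets_of_size (A i) (u i)))"
    using bij_betw_same_card[OF bij_graded_part] by (simp only: graded_codomain)
  then show ?thesis by (simp add: card_PiE card_multisets_of_size fin)
qed

lemma sum_copies: "(\<Sum>j<m. S) = sum_mset ` multisets_of_size S m" for S :: "'b set"
proof (induction m)
  case (Suc m)
  have "sum_mset ` multisets_of_size S m + S = sum_mset ` multisets_of_size S (Suc m)"
  proof (intro equalityI subsetI)
    fix s assume "s \<in> sum_mset ` multisets_of_size S m + S"
    then obtain M a where "M \<in> multisets_of_size S m" "a \<in> S" "s = sum_mset M + a"
      by (auto elim!: set_plus_elim)
    then show "s \<in> sum_mset ` multisets_of_size S (Suc m)"
      by (intro image_eqI[of _ _ "add_mset a M"]) (auto simp: multisets_of_size_def add.commute)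
  next
    fix s assume "s \<in> sum_mset ` multisets_of_size S (Suc m)"
    then obtain M where M: "set_mset M \<subseteq> S" "size M = Suc m" "s = sum_mset M"
      by (auto simp: multisets_of_size_def)
    then obtain a M' where M': "M = add_mset a M'" by (metis size_eq_Suc_imp_eq_union)
    then have "sum_mset M' + a \<in> sum_mset ` multisets_of_size S m + S"
      using M by (intro set_plus_intro imageI) (auto simp: multisets_of_size_def)
    then show "s \<in> sum_mset ` multisets_of_size S m + S" using M M' by (simp add: add.commute)
  qed
  then show ?case using Suc by simp
qed simp

lemma sumset_eq_element_sum: "(\<Sum>i\<in>UNIV. \<Sum>j<u i. A i) = element_sum ` graded_part u"
proof -
  have "(\<Sum>i\<in>UNIV. \<Sum>j<u i. A i)
      = (\<lambda>f. \<Sum>i\<in>UNIV. sum_mset (f i)) ` {f. \<forall>i. f i \<in> multisets_of_size (A i) (u i)}"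
  proof (intro equalityI subsetI)
    fix s assume "s \<in> (\<Sum>i\<in>UNIV. \<Sum>j<u i. A i)"
    then obtain t where t: "s = sum t UNIV" "\<And>i. t i \<in> sum_mset ` multisets_of_size (A i) (u i)"
      by (auto simp: set_sum_alt sum_copies)
    then have "\<forall>i. \<exists>M\<in>multisets_of_size (A i) (u i). t i = sum_mset M" by blast
    then obtain f where "\<And>i. f i \<in> multisets_of_size (A i) (u i)" "\<And>i. t i = sum_mset (f i)"
      by metis
    then show "s \<in> (\<lambda>f. \<Sum>i\<in>UNIV. sum_mset (f i)) ` {f. \<forall>i. f i \<in> multisets_of_size (A i) (u i)}"
      using t(1) by (intro image_eqI[of _ _ f]) auto
  next
    fix s assume "s \<in> (\<lambda>f. \<Sum>i\<in>UNIV. sum_mset (f i)) ` {f. \<forall>i. f i \<in> multisets_of_size (A i) (u i)}"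
    then show "s \<in> (\<Sum>i\<in>UNIV. \<Sum>j<u i. A i)"
      by (auto simp: set_sum_alt sum_copies)
  qed
  also have "\<dots> = element_sum ` graded_part u"
    unfolding bij_betw_imp_surj_on[OF bij_graded_part, symmetric] image_image
    by (rule image_cong) (simp_all only: element_sum_eq_sum)
  finally show ?thesis .
qed

lemma graded_part_above:
  assumes w: "set_mset w \<subseteq> Sigma UNIV A" and le: "\<And>i. grade w i \<le> u i"
  shows "{x \<in> graded_part u. w \<subseteq># x} = (+) w ` graded_part (\<lambda>i. u i - grade w i)"
proof (intro equalityI subsetI)
  fix x assume "x \<in> {x \<in> graded_part u. w \<subseteq># x}"
  then obtain y where y: "x = w + y" and x: "x \<in> graded_part u" by (auto simp: subset_mset.le_iff_add)
  then have "u = (\<lambda>i. grade w i + grade y i)" by (auto simp: graded_part_def grade_plus)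
  then have "y \<in> graded_part (\<lambda>i. u i - grade w i)" using x y by (auto simp: graded_part_def)
  then show "x \<in> (+) w ` graded_part (\<lambda>i. u i - grade w i)" using y by blast
next
  fix x assume "x \<in> (+) w ` graded_part (\<lambda>i. u i - grade w i)"
  then show "x \<in> {x \<in> graded_part u. w \<subseteq># x}" using w le by (auto simp: graded_part_def grade_plus)
qed

text \<open>Dividing by \<open>w\<close> identifies the multiples of \<open>w\<close> in grade
  \<open>u\<close> with the whole graded part of grade \<open>u - grade w\<close>, which is counted
  by a product of binomial coefficients.\<close>

lemma eventually_poly_above:
  assumes w: "set_mset w \<subseteq> Sigma UNIV A"
  shows "eventually_poly (\<lambda>u. real (card {x \<in> graded_part u. w \<subseteq># x}))"
  unfolding eventually_poly_def
proof (intro bexI exI allI impI)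
  let ?p = "\<lambda>x :: 'i \<Rightarrow> real. \<Prod>i\<in>UNIV. (x i + (real (card (A i)) - 1 - real (grade w i))) gchoose (card (A i) - 1)"
  show "?p \<in> polyfuns" by (intro polyfuns_prod polyfuns_gbinomial)
  \<comment> \<open>\<open>size w\<close> bounds every \<open>grade w i\<close>, so beyond it no
    subtraction on naturals is truncated.\<close>
  fix u :: "'i \<Rightarrow> nat" assume u: "\<forall>i. size w \<le> u i"
  have le: "grade w i \<le> u i" for i
    using u size_filter_mset_lesseq[of "\<lambda>p. fst p = i" w] unfolding grade_def by (metis order_trans)
  have card_pos: "card (A i) \<ge> 1" for i using fin[of i] ne[of i] by (simp add: Suc_le_eq card_gt_0_iff)
  have "card {x \<in> graded_part u. w \<subseteq># x} = card (graded_part (\<lambda>i. u i - grade w i))"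
    by (simp add: graded_part_above[OF w le] card_image)
  \<comment> \<open>By symmetry the lower index becomes the constant \<open>card (A i) - 1\<close>,
    and a binomial coefficient with fixed lower index is a polynomial in the upper one.\<close>
  also have "\<dots> = (\<Prod>i\<in>UNIV. (u i - grade w i + (card (A i) - 1)) choose (card (A i) - 1))"
    unfolding card_graded_part
  proof (rule prod.cong)
    fix i
    show "(card (A i) + (u i - grade w i) - 1) choose (u i - grade w i)
      = (u i - grade w i + (card (A i) - 1)) choose (card (A i) - 1)"
      using card_pos[of i] by (subst binomial_symmetric) (simp_all add: add.commute)
  qed simp
  also have "real \<dots> = ?p (\<lambda>i. real (u i))"
    unfolding of_nat_prod binomial_gbinomial
  proof (rule prod.cong)
    fix i
    show "real (u i - grade w i + (card (A i) - 1)) gchoose (card (A i) - 1) =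
      (real (u i) + (real (card (A i)) - 1 - real (grade w i))) gchoose (card (A i) - 1)"
      using card_pos[of i] le[of i] by (simp add: of_nat_diff algebra_simps)
  qed simp
  finally show "real (card {x \<in> graded_part u. w \<subseteq># x}) = ?p (\<lambda>i. real (u i))" .
qed

text \<open>Inclusion-exclusion, one generator at a time. The common multiples of \<open>g\<close>
  and \<open>f\<close> are the multiples of their least common multiple
  \<open>g \<union># f\<close>. There are at most \<open>card G\<close> such least common multiples,
  fewer than \<open>card F\<close>, so the induction applies to them too.\<close>

lemma eventually_poly_above_some:
  assumes "finite F" "\<And>f. f \<in> F \<Longrightarrow> set_mset f \<subseteq> Sigma UNIV A"
  shows "eventually_poly (\<lambda>u. real (card {x \<in> graded_part u. \<exists>f\<in>F. f \<subseteq># x}))"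
  using assms
proof (induction "card F" arbitrary: F rule: less_induct)
  case less
  show ?case
  proof (cases "F = {}")
    case True
    then show ?thesis using polyfuns.const[of 0] by (auto simp: eventually_poly_def)
  next
    case False
    then obtain g G where F: "F = insert g G" "g \<notin> G" "finite G"
      using less.prems(1) by (metis finite.cases finite_insert insertI1 mk_disjoint_insert)
    let ?U = "\<lambda>u. {x \<in> graded_part u. \<exists>f\<in>G. f \<subseteq># x}" and ?V = "\<lambda>u. {x \<in> graded_part u. g \<subseteq># x}"
    let ?W = "\<lambda>u. {x \<in> graded_part u. \<exists>f\<in>(\<union>#) g ` G. f \<subseteq># x}"
    have U: "eventually_poly (\<lambda>u. real (card (?U u)))" using less.prems F by (intro less.hyps) auto
    have V: "eventually_poly (\<lambda>u. real (card (?V u)))" using less.prems F by (intro eventually_poly_above) auto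
    have W: "eventually_poly (\<lambda>u. real (card (?W u)))"
    proof -
      have "card ((\<union>#) g ` G) < card F" using F card_image_le[of G "(\<union>#) g"] by simp
      moreover have sub: "set_mset f \<subseteq> Sigma UNIV A" if "f \<in> (\<union>#) g ` G" for f
        using that less.prems(2) unfolding F(1) by (elim imageE) (simp add: set_mset_sup)
      ultimately show ?thesis using F(3) by (intro less.hyps) auto
    qed
    have "real (card {x \<in> graded_part u. \<exists>f\<in>F. f \<subseteq># x})
        = real (card (?U u)) + real (card (?V u)) - real (card (?W u))" for u
    proof -
      have "{x \<in> graded_part u. \<exists>f\<in>F. f \<subseteq># x} = ?U u \<union> ?V u" "?W u = ?U u \<inter> ?V u"
        using F by auto
      then show ?thesis using card_Un_Int[of "?U u" "?V u"] finite_graded_part[of u] by simp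
    qed
    then show ?thesis
      using eventually_poly_combine[OF eventually_poly_combine[OF U V polyfuns.add] W polyfuns_diff]
      by simp
  qed
qed


text \<open>
  Each element of the sumset is represented by the multiset over it that is minimal in an additive
  total order. Because the order is additive, the remaining multisets are closed under adding
  elements, so Dickson's lemma generates them by finitely many.
\<close>

theorem card_sumset_eventually_poly:
  "eventually_poly (\<lambda>u. real (card (\<Sum>i\<in>UNIV. \<Sum>j<u i. A i)))"
proof -
  have finP: "finite (Sigma UNIV A)" using fin by (intro finite_SigmaI) auto
  \<comment> \<open>Numbering the finitely many pairs carries multisets over them to multisets of
    naturals, whose multiset order is total and compatible with addition.\<close>
  define c where "c = image_mset (to_nat_on (Sigma UNIV A))"
  have c_inv: "image_mset (inv_into (Sigma UNIV A) (to_nat_on (Sigma UNIV A))) (c x) = x"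
    if "set_mset x \<subseteq> Sigma UNIV A" for x
  proof -
    have "image_mset (inv_into (Sigma UNIV A) (to_nat_on (Sigma UNIV A))) (c x) = image_mset (\<lambda>p. p) x"
      unfolding c_def multiset.map_comp
      using that inj_on_to_nat_on[OF countable_finite[OF finP]]
      by (intro image_mset_cong) (auto intro!: inv_into_f_f)
    then show ?thesis by simp
  qed
  then have c_inj: "x = y" if "set_mset x \<subseteq> Sigma UNIV A" "set_mset y \<subseteq> Sigma UNIV A" "c x = c y" for x y
    using that by metis
  define W where "W = {x. set_mset x \<subseteq> Sigma UNIV A \<and>
    (\<exists>y. set_mset y \<subseteq> Sigma UNIV A \<and> grade y = grade x \<and> element_sum y = element_sum x \<and> c y < c x)}"
  obtain F where F: "finite F" "F \<subseteq> W" "\<And>w. w \<in> W \<Longrightarrow> \<exists>f\<in>F. f \<subseteq># w"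
    by (rule dickson[OF finP, of W]) (auto simp: W_def)
  have up: "x \<in> W" if fx: "f \<in> W" "f \<subseteq># x" "set_mset x \<subseteq> Sigma UNIV A" for f x
  proof -
    obtain z where z: "x = f + z" using fx(2) by (auto simp: subset_mset.le_iff_add)
    obtain y where y: "set_mset y \<subseteq> Sigma UNIV A" "grade y = grade f" "element_sum y = element_sum f" "c y < c f"
      using fx(1) by (auto simp: W_def)
    have "c (y + z) < c x" using y(4) by (simp add: z c_def)
    moreover have "set_mset (y + z) \<subseteq> Sigma UNIV A" using y(1) fx(3) z by auto
    ultimately show ?thesis using y fx(3) unfolding W_def
      by (auto intro!: exI[of _ "y + z"] simp: z grade_plus element_sum_plus)
  qed
  have W_eq: "graded_part u \<inter> W = {x \<in> graded_part u. \<exists>f\<in>F. f \<subseteq># x}" for u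
    using F up by (auto simp: graded_part_def)
  have "bij_betw element_sum (graded_part u - W) (element_sum ` graded_part u)" for u
  proof (rule bij_betw_imageI)
    show "inj_on element_sum (graded_part u - W)"
    proof (rule inj_onI)
      fix x y assume xy: "x \<in> graded_part u - W" "y \<in> graded_part u - W" "element_sum x = element_sum y"
      then have "\<not> c x < c y" "\<not> c y < c x" by (auto simp: graded_part_def W_def)
      then have "c x = c y" by simp
      then show "x = y" using xy by (intro c_inj) (auto simp: graded_part_def)
    qed
    show "element_sum ` (graded_part u - W) = element_sum ` graded_part u"
    proof (intro equalityI subsetI)
      fix s assume "s \<in> element_sum ` graded_part u"
      then obtain x where x: "x \<in> graded_part u" "s = element_sum x" by blast
      define R where "R = {y \<in> graded_part u. element_sum y = s}"
      have "finite (c ` R)" "c ` R \<noteq> {}" using x finite_graded_part[of u] by (auto simp: R_def)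
      then have "Min (c ` R) \<in> c ` R" by (rule Min_in)
      then obtain y where y: "y \<in> R" "c y = Min (c ` R)" by auto
      have "y \<notin> W"
      proof
        assume "y \<in> W"
        then obtain z where "z \<in> R" "c z < c y" using y(1) by (auto simp: W_def R_def graded_part_def)
        then show False using Min_le[OF \<open>finite (c ` R)\<close>, of "c z"] y(2) by simp
      qed
      then show "s \<in> element_sum ` (graded_part u - W)" using y(1) by (auto simp: R_def)
    qed auto
  qed
  then have "card (element_sum ` graded_part u) = card (graded_part u - W)" for u
    using bij_betw_same_card by metis
  \<comment> \<open>The empty multiset lies below everything, so the full graded part is itself a
    count of the kind treated by \<open>eventually_poly_above\<close>.\<close>
  moreover have "real (card (graded_part u - W)) = real (card {x \<in> graded_part u. {#} \<subseteq># x})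
      - real (card {x \<in> graded_part u. \<exists>f\<in>F. f \<subseteq># x})" for u
    using card_Diff_subset_Int[of "graded_part u" W] finite_graded_part[of u]
      card_mono[of "graded_part u" "graded_part u \<inter> W"]
    by (simp add: W_eq of_nat_diff)
  ultimately show ?thesis
    unfolding sumset_eq_element_sum
    using eventually_poly_combine[OF eventually_poly_above[of "{#}"]
        eventually_poly_above_some[of F] polyfuns_diff] F(1,2)
    by (auto simp: W_def subset_iff)
qed

end

subsection \<open>Multivariate polynomials\<close>

lemma mpoly_eval_superset:
  assumes "finite S" "Poly_Mapping.keys P \<subseteq> S"
  shows "mpoly_eval P x = (\<Sum>a\<in>S. Poly_Mapping.lookup P a * (\<Prod>v\<in>UNIV. x v ^ Poly_Mapping.lookup a v))"
  unfolding mpoly_eval_def using assms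
  by (intro sum.mono_neutral_left) (auto simp: in_keys_iff)

lemma mpoly_eval_add: "mpoly_eval (P + Q) x = mpoly_eval P x + mpoly_eval Q x"
proof -
  let ?S = "Poly_Mapping.keys P \<union> Poly_Mapping.keys Q"
  have fin: "finite ?S" by simp
  show ?thesis
    using mpoly_eval_superset[OF fin, of "P + Q" x] mpoly_eval_superset[OF fin, of P x]
      mpoly_eval_superset[OF fin, of Q x] Poly_Mapping.keys_add[of P Q]
    by (simp add: lookup_add distrib_right sum.distrib)
qed

lemma mpoly_eval_single:
  "mpoly_eval (Poly_Mapping.single a c) x = c * (\<Prod>v\<in>UNIV. x v ^ Poly_Mapping.lookup a v)"
  by (cases "c = 0") (auto simp: mpoly_eval_def)

lemma mpoly_eval_sum: "mpoly_eval (\<Sum>i\<in>I. P i) x = (\<Sum>i\<in>I. mpoly_eval (P i) x)"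
  by (induction I rule: infinite_finite_induct) (auto simp: mpoly_eval_add, simp_all add: mpoly_eval_def)

lemma polyfun_is_mpoly:
  fixes f :: "('v::finite \<Rightarrow> real) \<Rightarrow> real"
  assumes "f \<in> polyfuns"
  shows "\<exists>P. \<forall>x. f x = mpoly_eval P x"
  using assms
proof induction
  case (const c)
  show ?case by (rule exI[of _ "Poly_Mapping.single 0 c"]) (simp add: mpoly_eval_single)
next
  case (add f g)
  then show ?case by (metis mpoly_eval_add)
next
  case (var_mult f v)
  then obtain P where P: "\<And>x. f x = mpoly_eval P x" by blast
  have pow: "(\<Prod>w\<in>UNIV. x w ^ Poly_Mapping.lookup (Poly_Mapping.single v 1) w) = x v"
    for x :: "'v \<Rightarrow> real"
  proof -
    have "(\<Prod>w\<in>UNIV. x w ^ Poly_Mapping.lookup (Poly_Mapping.single v 1) w)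
        = (\<Prod>w\<in>UNIV. if w = v then x v else 1)"
      by (rule prod.cong) (auto simp: lookup_single)
    then show ?thesis by simp
  qed
  let ?Q = "\<Sum>a\<in>Poly_Mapping.keys P. Poly_Mapping.single (Poly_Mapping.single v 1 + a) (Poly_Mapping.lookup P a)"
  have "x v * f x = mpoly_eval ?Q x" for x
    unfolding P mpoly_eval_sum mpoly_eval_single lookup_add power_add prod.distrib pow
    by (simp add: mpoly_eval_def sum_distrib_left ac_simps)
  then show ?case by blast
qed

text \<open>
  As in a base-\<open>B\<close> expansion, each new weight exceeds every value of the earlier ones. Substituting
  \<open>t ^ w v\<close> for the variable \<open>v\<close> then turns distinct monomials into distinct powers of \<open>t\<close>.
\<close>

lemma separating_weights:
  assumes "finite F"
  shows "\<exists>w :: 'v \<Rightarrow> nat. (\<forall>v\<in>F. 1 \<le> w v) \<and>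
    (\<forall>a b. (\<forall>v\<in>F. a v < B \<and> b v < B) \<longrightarrow> (\<Sum>v\<in>F. a v * w v) = (\<Sum>v\<in>F. b v * w v) \<longrightarrow> (\<forall>v\<in>F. a v = b v))"
  using assms
proof (induction F)
  case (insert q F)
  then obtain w :: "'v \<Rightarrow> nat" where w: "(\<forall>v\<in>F. 1 \<le> w v) \<and>
    (\<forall>a b. (\<forall>v\<in>F. a v < B \<and> b v < B) \<longrightarrow> (\<Sum>v\<in>F. a v * w v) = (\<Sum>v\<in>F. b v * w v) \<longrightarrow> (\<forall>v\<in>F. a v = b v))"
    by blast
  define C where "C = Suc (\<Sum>v\<in>F. B * w v)"
  let ?w = "w(q := C)"
  have small: "(\<Sum>v\<in>F. a v * w v) < C" if "\<And>v. v \<in> F \<Longrightarrow> a v < B" for a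
    unfolding C_def less_Suc_eq_le using that by (intro sum_mono mult_right_mono) (auto intro: less_imp_le)
  have split: "(\<Sum>v\<in>insert q F. a v * ?w v) = a q * C + (\<Sum>v\<in>F. a v * w v)" for a
  proof -
    have "(\<Sum>v\<in>F. a v * ?w v) = (\<Sum>v\<in>F. a v * w v)" using insert.hyps(2) by (intro sum.cong) auto
    then show ?thesis using insert.hyps by simp
  qed
  have "\<forall>v\<in>insert q F. a v = b v"
    if ab: "\<forall>v\<in>insert q F. a v < B \<and> b v < B"
      and eq: "(\<Sum>v\<in>insert q F. a v * ?w v) = (\<Sum>v\<in>insert q F. b v * ?w v)" for a b
  proof -
    let ?s = "\<lambda>a. \<Sum>v\<in>F. a v * w v"
    have s: "?s a < C" "?s b < C" using ab small by auto
    have eq': "a q * C + ?s a = b q * C + ?s b" using eq unfolding split .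
    then have "(a q * C + ?s a) mod C = (b q * C + ?s b) mod C" "(a q * C + ?s a) div C = (b q * C + ?s b) div C"
      by simp_all
    then have "?s a = ?s b" "a q = b q" using s by simp_all
    then show ?thesis using w ab by blast
  qed
  moreover have "\<forall>v\<in>insert q F. 1 \<le> ?w v" using w by (auto simp: C_def)
  ultimately show ?case by blast
qed auto

text \<open>Kronecker substitution. The univariate \<open>p(t) = P(t ^ w v)\<close> vanishes at all
  integers t > N, because positive weights keep the arguments at least N; hence p = 0. The weights
  separate the monomials of P, so no two of its coefficients are merged in p.\<close>

lemma mpoly_eq_0_if_eval_eq_0:
  fixes P :: "('v::finite, real) mpoly"
  assumes zero: "\<And>u. (\<And>v. N \<le> u v) \<Longrightarrow> mpoly_eval P (\<lambda>v. real (u v)) = 0"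
  shows "P = 0"
proof (rule poly_mapping_eqI)
  fix a
  show "Poly_Mapping.lookup P a = Poly_Mapping.lookup 0 a"
  proof (cases "a \<in> Poly_Mapping.keys P")
    case True
    define B where "B = Suc (\<Sum>a\<in>Poly_Mapping.keys P. \<Sum>v\<in>UNIV. Poly_Mapping.lookup a v)"
    have B: "Poly_Mapping.lookup a v < B" if "a \<in> Poly_Mapping.keys P" for a v
    proof -
      have "Poly_Mapping.lookup a v \<le> (\<Sum>v\<in>UNIV. Poly_Mapping.lookup a v)" by (rule member_le_sum) auto
      also have "\<dots> \<le> (\<Sum>a\<in>Poly_Mapping.keys P. \<Sum>v\<in>UNIV. Poly_Mapping.lookup a v)"
        using that by (intro member_le_sum[of a]) auto
      finally show ?thesis by (simp add: B_def)
    qed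
    obtain w :: "'v \<Rightarrow> nat" where w: "(\<forall>v\<in>UNIV. 1 \<le> w v) \<and>
      (\<forall>a b. (\<forall>v\<in>UNIV. a v < B \<and> b v < B) \<longrightarrow>
        (\<Sum>v\<in>UNIV. a v * w v) = (\<Sum>v\<in>UNIV. b v * w v) \<longrightarrow> (\<forall>v\<in>UNIV. a v = b v))"
      using separating_weights[OF finite, of UNIV B] by blast
    define wt where "wt = (\<lambda>a. \<Sum>v\<in>UNIV. Poly_Mapping.lookup a v * w v)"
    define p where "p = (\<Sum>a\<in>Poly_Mapping.keys P. monom (Poly_Mapping.lookup P a) (wt a))"
    have inj: "b = a" if "b \<in> Poly_Mapping.keys P" "wt b = wt a" for b
    proof (rule poly_mapping_eqI)
      show "Poly_Mapping.lookup b v = Poly_Mapping.lookup a v" for v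
        using w that B True unfolding wt_def by blast
    qed
    have p_eval: "poly p t = mpoly_eval P (\<lambda>v. t ^ w v)" for t
      by (simp add: p_def poly_sum poly_monom mpoly_eval_def wt_def power_sum
          flip: power_mult) (simp add: mult.commute)
    have "poly p (real (Suc N + k)) = 0" for k
    proof -
      have "N \<le> (Suc N + k) ^ w v" for v
      proof -
        have "N \<le> (Suc N + k) ^ 1" by simp
        also have "\<dots> \<le> (Suc N + k) ^ w v" using w by (intro power_increasing) auto
        finally show ?thesis .
      qed
      from zero[of "\<lambda>v. (Suc N + k) ^ w v", OF this] show ?thesis unfolding p_eval by simp
    qed
    then have "range (\<lambda>k. real (Suc N + k)) \<subseteq> {t. poly p t = 0}" by auto
    moreover have "infinite (range (\<lambda>k. real (Suc N + k)))"
      by (rule range_inj_infinite) (auto simp: inj_def)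
    ultimately have "p = 0" using poly_roots_finite finite_subset by blast
    then have "0 = coeff p (wt a)" by simp
    also have "\<dots> = (\<Sum>b\<in>Poly_Mapping.keys P. if b = a then Poly_Mapping.lookup P a else 0)"
      unfolding p_def coeff_sum using inj by (intro sum.cong) auto
    also have "\<dots> = Poly_Mapping.lookup P a" using True by simp
    finally show ?thesis by simp
  qed (simp add: in_keys_iff)
qed

text \<open>The uniqueness required by the \<open>THE\<close> in
  \<open>mixed_hilbert_poly\<close>.\<close>

lemma mpoly_eqI_large:
  fixes P Q :: "('v::finite, real) mpoly"
  assumes "\<And>u. (\<And>v. N \<le> u v) \<Longrightarrow> mpoly_eval P (\<lambda>v. real (u v)) = mpoly_eval Q (\<lambda>v. real (u v))"
  shows "P = Q"
proof -
  have "mpoly_eval (P - Q) x = mpoly_eval P x - mpoly_eval Q x" for x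
    using mpoly_eval_add[of "P - Q" Q x] by simp
  then have "P - Q = 0" using assms by (intro mpoly_eq_0_if_eval_eq_0[of N]) auto
  then show ?thesis by simp
qed

section \<open>Homogeneous parts and the coefficient of u_1 ... u_n\<close>

definition homogeneous_part :: "nat \<Rightarrow> ('v::finite, real) mpoly \<Rightarrow> ('v \<Rightarrow> real) \<Rightarrow> real" where
  "homogeneous_part d P x = (\<Sum>a | a \<in> Poly_Mapping.keys P \<and> mon_degree a = d.
     Poly_Mapping.lookup P a * (\<Prod>v\<in>UNIV. x v ^ Poly_Mapping.lookup a v))"

text \<open>The degree of \<open>q\<close> is not bounded in advance. Dropping the constant
  coefficient \<open>a\<close> changes the quotient by a / t^(d+1), which tends to 0, so
  \<open>d\<close> can be lowered; at d = 0 a nonconstant polynomial would diverge.\<close>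

lemma coeff_eq_limit:
  fixes q :: "real poly"
  assumes "(\<lambda>t. poly q (real t) / real t ^ d) \<longlonglongrightarrow> L"
  shows "coeff q d = L"
  using assms
proof (induction d arbitrary: q)
  case 0
  then have lim: "(\<lambda>t. poly q (real t)) \<longlonglongrightarrow> L" by simp
  show ?case
  proof (cases "degree q = 0")
    case True
    then obtain c where "q = [:c:]" by (metis degree_eq_zeroE)
    then show ?thesis using lim by (simp add: LIMSEQ_const_iff)
  next
    case False
    then have "filterlim (poly q) at_infinity at_infinity" by (intro filterlim_poly_at_infinity) auto
    then have "filterlim (\<lambda>t. poly q (real t)) at_infinity sequentially"
      by (rule filterlim_compose) (rule tendsto_of_nat)
    then show ?thesis using not_tendsto_and_filterlim_at_infinity[OF _ lim] by simp
  qed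
next
  case (Suc d)
  obtain a q' where q: "q = pCons a q'" by (cases q)
  have "(\<lambda>t. poly q (real t) / real t ^ Suc d - a * (1 / real t) ^ Suc d) \<longlonglongrightarrow> L - a * 0 ^ Suc d"
    by (intro tendsto_intros Suc.prems lim_1_over_n)
  moreover have "\<forall>\<^sub>F t in sequentially. poly q (real t) / real t ^ Suc d - a * (1 / real t) ^ Suc d
      = poly q' (real t) / real t ^ d"
    using eventually_gt_at_top[of 0] by eventually_elim (simp add: q field_simps)
  ultimately have "(\<lambda>t. poly q' (real t) / real t ^ d) \<longlonglongrightarrow> L"
    by (simp add: tendsto_cong)
  from Suc.IH[OF this] show ?case by (simp add: q)
qed

text \<open>Along the ray through \<open>x\<close>, P becomes a univariate polynomial in t whose
  coefficient at t^d collects exactly the terms of total degree d.\<close>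

lemma homogeneous_part_eq_limit:
  fixes P :: "('v::finite, real) mpoly"
  assumes "(\<lambda>t. mpoly_eval P (\<lambda>v. real t * x v) / real t ^ d) \<longlonglongrightarrow> L"
  shows "homogeneous_part d P x = L"
proof -
  define c where "c = (\<lambda>a. Poly_Mapping.lookup P a * (\<Prod>v\<in>UNIV. x v ^ Poly_Mapping.lookup a v))"
  define q where "q = (\<Sum>a\<in>Poly_Mapping.keys P. monom (c a) (mon_degree a))"
  have "poly q t = mpoly_eval P (\<lambda>v. t * x v)" for t
    by (simp add: q_def c_def poly_sum poly_monom mpoly_eval_def mon_degree_def power_sum
        power_mult_distrib prod.distrib mult.assoc) (simp add: mult.commute)
  then have "coeff q d = L" using assms by (intro coeff_eq_limit) simp
  moreover have "coeff q d = (\<Sum>a\<in>Poly_Mapping.keys P. if mon_degree a = d then c a else 0)"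
    by (simp add: q_def coeff_sum)
  moreover have "homogeneous_part d P x = (\<Sum>a | a \<in> Poly_Mapping.keys P \<and> mon_degree a = d. c a)"
    by (simp add: homogeneous_part_def c_def)
  ultimately show ?thesis by (simp add: sum.inter_filter)
qed

lemma homogeneous_part_scale:
  "homogeneous_part d P (\<lambda>v. t * x v) = t ^ d * homogeneous_part d P x"
  unfolding homogeneous_part_def sum_distrib_left
  by (rule sum.cong) (auto simp: power_mult_distrib prod.distrib mon_degree_def power_sum)

lemma tendsto_homogeneous_part:
  assumes "\<And>v. ((\<lambda>t. f t v) \<longlongrightarrow> x v) F"
  shows "((\<lambda>t. homogeneous_part d P (f t)) \<longlongrightarrow> homogeneous_part d P x) F"
  unfolding homogeneous_part_def by (intro tendsto_intros assms)

text \<open>In terms of complements this is the alternating sum over all subsets of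
  \<open>- S\<close>, the expansion of a product of factors -1 + 1 over \<open>- S\<close>. It
  vanishes unless that product is empty.\<close>

lemma sum_signed_supersets:
  fixes S :: "'n::finite set"
  shows "(\<Sum>H\<in>UNIV. (-1) ^ (CARD('n) - card H) * (if S \<subseteq> H then 1 else 0)) = (if S = UNIV then 1 else 0 :: real)"
proof -
  have "(\<Sum>H\<in>UNIV. (-1) ^ (CARD('n) - card H) * (if S \<subseteq> H then 1 else 0 :: real))
      = (\<Sum>H | S \<subseteq> H. (-1) ^ card (- H))"
    by (simp add: sum.inter_filter[symmetric] Compl_eq_Diff_UNIV card_Diff_subset if_distrib cong: if_cong)
  also have "\<dots> = (\<Sum>K\<in>Pow (- S). (-1) ^ card K)"
    by (rule sum.reindex_bij_witness[of _ "\<lambda>K. - K" "\<lambda>H. - H"]) auto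
  also have "\<dots> = (if S = UNIV then 1 else 0)"
    using prod_add[of "- S" "\<lambda>_. -1 :: real" "\<lambda>_. 1"]
    by (cases "- S = {}") (auto simp: power_0_left)
  finally show ?thesis .
qed

lemma mon_degree_option:
  "mon_degree a = Poly_Mapping.lookup a None + (\<Sum>i\<in>UNIV. Poly_Mapping.lookup a (Some i))"
  for a :: "'n::finite option monomial"
  by (simp add: mon_degree_def UNIV_option_conv sum.reindex)

text \<open>At the 0/1 point of H a monomial is 1 if it is free of u_0 and its support lies in H,
  and 0 otherwise. The signed sum therefore keeps only monomials in which all of u_1, ..., u_n
  occur, and in degree n there is just one of these.\<close>

lemma alternating_sum_homogeneous_part:
  fixes P :: "('n::finite option, real) mpoly"
  shows "(\<Sum>H\<in>UNIV. (-1) ^ (CARD('n) - card H) * homogeneous_part CARD('n) P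
      (\<lambda>v. case v of None \<Rightarrow> 0 | Some i \<Rightarrow> if i \<in> H then 1 else 0))
    = Poly_Mapping.lookup P (Abs_poly_mapping (\<lambda>v. case v of None \<Rightarrow> 0 | Some i \<Rightarrow> 1))"
proof -
  let ?x = "\<lambda>H v. case v of None \<Rightarrow> 0 | Some (i :: 'n) \<Rightarrow> if i \<in> H then 1 else (0 :: real)"
  let ?l = "Poly_Mapping.lookup :: 'n option monomial \<Rightarrow> _"
  define T where "T = {a. a \<in> Poly_Mapping.keys P \<and> mon_degree a = CARD('n)}"
  define e :: "'n option monomial" where "e = Abs_poly_mapping (\<lambda>v. case v of None \<Rightarrow> 0 | Some i \<Rightarrow> 1)"
  have e: "?l e v = (case v of None \<Rightarrow> 0 | Some i \<Rightarrow> 1)" for v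
    unfolding e_def by (simp split: option.split)
  have prod: "(\<Prod>v\<in>UNIV. ?x H v ^ ?l a v)
      = (if ?l a None = 0 then 1 else 0) * (if {i. ?l a (Some i) \<noteq> 0} \<subseteq> H then 1 else 0)" for H a
  proof -
    \<comment> \<open>Since \<open>0 ^ 0 = 1\<close>, the factor at \<open>None\<close> tests
      whether u_0 is absent.\<close>
    have "(\<Prod>v\<in>UNIV. ?x H v ^ ?l a v) = 0 ^ ?l a None * (\<Prod>i\<in>UNIV. (if i \<in> H then 1 else 0) ^ ?l a (Some i))"
      by (simp add: UNIV_option_conv prod.reindex)
    also have "(\<Prod>i\<in>UNIV. (if i \<in> H then 1 else 0 :: real) ^ ?l a (Some i))
        = (if {i. ?l a (Some i) \<noteq> 0} \<subseteq> H then 1 else 0)"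
    proof (cases "{i. ?l a (Some i) \<noteq> 0} \<subseteq> H")
      case True
      then show ?thesis by (auto intro!: prod.neutral simp: power_0_left)
    next
      case False
      then show ?thesis by (auto intro!: prod_zero)
    qed
    finally show ?thesis by (simp add: power_0_left)
  qed
  have coef: "(\<Sum>H\<in>UNIV. (-1) ^ (CARD('n) - card H) * (\<Prod>v\<in>UNIV. ?x H v ^ ?l a v)) = (if a = e then 1 else 0)"
    if "a \<in> T" for a
  proof -
    have "(\<Sum>H\<in>UNIV. (-1) ^ (CARD('n) - card H) * (\<Prod>v\<in>UNIV. ?x H v ^ ?l a v))
      = (if ?l a None = 0 then 1 else 0) * (\<Sum>H\<in>UNIV. (-1) ^ (CARD('n) - card H) *
          (if {i. ?l a (Some i) \<noteq> 0} \<subseteq> H then 1 else 0))"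
      unfolding prod sum_distrib_left by (rule sum.cong) auto
    also have "\<dots> = (if ?l a None = 0 \<and> (\<forall>i. ?l a (Some i) \<noteq> 0) then 1 else 0)"
      unfolding sum_signed_supersets by auto
    also have "(?l a None = 0 \<and> (\<forall>i. ?l a (Some i) \<noteq> 0)) \<longleftrightarrow> a = e"
    proof
      assume a: "?l a None = 0 \<and> (\<forall>i. ?l a (Some i) \<noteq> 0)"
      \<comment> \<open>Membership in \<open>T\<close> makes the exponents sum to n, and n positive
        integers with sum n are all 1.\<close>
      have "(\<Sum>i\<in>UNIV. ?l a (Some i)) = (\<Sum>i\<in>(UNIV :: 'n set). 1)"
        using that a by (simp add: T_def mon_degree_option)
      then have "?l a (Some i) = 1" for i
        using a sum_mono_inv[of "\<lambda>_. 1" "UNIV :: 'n set" "\<lambda>i. ?l a (Some i)" i] by (simp add: Suc_le_eq)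
      then show "a = e" using a by (intro poly_mapping_eqI) (auto simp: e split: option.split)
    qed (auto simp: e)
    finally show ?thesis .
  qed
  have "(\<Sum>H\<in>UNIV. (-1) ^ (CARD('n) - card H) * homogeneous_part CARD('n) P (?x H))
      = (\<Sum>H\<in>UNIV. \<Sum>a\<in>T. (-1) ^ (CARD('n) - card H) * (Poly_Mapping.lookup P a * (\<Prod>v\<in>UNIV. ?x H v ^ ?l a v)))"
    by (simp only: homogeneous_part_def T_def sum_distrib_left)
  also have "\<dots> = (\<Sum>a\<in>T. \<Sum>H\<in>UNIV. (-1) ^ (CARD('n) - card H) * (Poly_Mapping.lookup P a * (\<Prod>v\<in>UNIV. ?x H v ^ ?l a v)))"
    by (rule sum.swap)
  also have "\<dots> = (\<Sum>a\<in>T. Poly_Mapping.lookup P a * (\<Sum>H\<in>UNIV. (-1) ^ (CARD('n) - card H) * (\<Prod>v\<in>UNIV. ?x H v ^ ?l a v)))"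
    by (simp only: sum_distrib_left mult.left_commute)
  also have "\<dots> = (\<Sum>a\<in>T. if a = e then Poly_Mapping.lookup P e else 0)"
    by (rule sum.cong) (simp_all add: coef)
  also have "\<dots> = Poly_Mapping.lookup P e"
  proof -
    have "e \<in> Poly_Mapping.keys P \<Longrightarrow> e \<in> T" by (simp add: T_def mon_degree_option e)
    moreover have "finite T" by (simp add: T_def)
    ultimately show ?thesis by (auto simp: in_keys_iff)
  qed
  finally show ?thesis by (simp add: e_def)
qed

subsection \<open>Volume growth of dilated lattice sets\<close>

lemma set_scaleR_convex_add:
  fixes C :: "'a::real_vector set"
  assumes "convex C" "0 \<le> s" "0 \<le> t"
  shows "(*\<^sub>R) (s + t) ` C = (*\<^sub>R) s ` C + (*\<^sub>R) t ` C"
proof (intro equalityI subsetI)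
  fix x assume "x \<in> (*\<^sub>R) (s + t) ` C"
  then show "x \<in> (*\<^sub>R) s ` C + (*\<^sub>R) t ` C" by (auto simp: scaleR_add_left)
next
  fix x assume "x \<in> (*\<^sub>R) s ` C + (*\<^sub>R) t ` C"
  then obtain a b where ab: "a \<in> C" "b \<in> C" "x = s *\<^sub>R a + t *\<^sub>R b" by (auto elim!: set_plus_elim)
  show "x \<in> (*\<^sub>R) (s + t) ` C"
  proof (cases "s + t = 0")
    case True
    then have "s = 0" "t = 0" using assms by auto
    then show ?thesis using ab by auto
  next
    case False
    let ?y = "(s / (s + t)) *\<^sub>R a + (t / (s + t)) *\<^sub>R b"
    have "?y \<in> C" using assms ab False
      by (intro convexD) (auto simp: add_divide_distrib[symmetric])
    moreover have "x = (s + t) *\<^sub>R ?y" using False by (simp add: ab scaleR_add_right)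
    ultimately show ?thesis by blast
  qed
qed

lemma sum_copies_convex:
  fixes C :: "'a::real_vector set"
  assumes "convex C" "C \<noteq> {}"
  shows "(\<Sum>j<m. C) = (*\<^sub>R) (real m) ` C"
proof (induction m)
  case 0
  \<comment> \<open>The empty sum is {0}, and \<open>0 *\<^sub>R C\<close> equals {0} only for
    nonempty \<open>C\<close>.\<close>
  then show ?case using assms(2) by (auto simp: image_constant_conv)
next
  case (Suc m)
  then show ?case using set_scaleR_convex_add[OF assms(1), of "real m" 1]
    by (simp add: add.commute)
qed

lemma compact_set_plus:
  fixes S T :: "'a::real_normed_vector set"
  assumes "compact S" "compact T"
  shows "compact (S + T)"
proof -
  have "S + T = {x + y | x y. x \<in> S \<and> y \<in> T}" by (auto simp: set_plus_def)
  then show ?thesis using compact_sums[OF assms] by simp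
qed

lemma measure_scaleR:
  fixes S :: "'a::euclidean_space set"
  shows "measure lebesgue ((*\<^sub>R) c ` S) = \<bar>c\<bar> ^ DIM('a) * measure lebesgue S"
  using measure_lebesgue_affine[of c 0 S] by simp

text \<open>Squeezed from below by a translate of \<open>K\<close>, and from above by closed
  neighbourhoods of \<open>K\<close> whose radii shrink to 0. These decrease to \<open>K\<close>
  because \<open>K\<close> is closed, and their measures are finite, so the measure passes to the
  limit.\<close>

lemma tendsto_measure_plus_small:
  fixes K L :: "'a::euclidean_space set"
  assumes K: "compact K" and L: "compact L" "L \<noteq> {}"
  shows "(\<lambda>t. measure lebesgue (K + (*\<^sub>R) (1 / real t) ` L)) \<longlonglongrightarrow> measure lebesgue K"
proof -
  obtain l where l: "l \<in> L" using L(2) by blast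
  obtain R where R: "0 < R" "\<And>x. x \<in> L \<Longrightarrow> norm x \<le> R"
    using compact_imp_bounded[OF L(1)] bounded_pos by blast
  \<comment> \<open>The index is shifted because division by 0 yields 0: at t = 0 the radius would
    collapse and \<open>N\<close> would not be decreasing. The shift is undone at the end by
    \<open>LIMSEQ_imp_Suc\<close>.\<close>
  define N where "N = (\<lambda>t. K + cball 0 (R / real (Suc t)))"
  have N_compact: "compact (N t)" for t unfolding N_def by (intro compact_set_plus K compact_cball)
  have small_compact: "compact (K + (*\<^sub>R) (1 / real t) ` L)" for t
    by (intro compact_set_plus K compact_scaling L)
  have "(\<lambda>t. measure lebesgue (N t)) \<longlonglongrightarrow> measure lebesgue (\<Inter>t. N t)"
  proof (rule Lim_measure_decseq)
    show "range N \<subseteq> sets lebesgue" using N_compact lmeasurable_compact by blast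
    show "decseq N" unfolding decseq_Suc_iff N_def
      using R(1) by (intro allI set_plus_mono2 subset_refl subset_cball divide_left_mono) auto
    show "emeasure lebesgue (N i) \<noteq> \<infinity>" for i
      using fmeasurableD2[OF lmeasurable_compact[OF N_compact]] by (simp only: infinity_ennreal_def not_False_eq_True)
  qed
  also have "(\<Inter>t. N t) = K"
  proof (intro equalityI subsetI)
    fix x assume x: "x \<in> (\<Inter>t. N t)"
    have "\<exists>k\<in>K. dist k x < e" if "e > 0" for e
    proof -
      obtain t where t: "R / e < real (Suc t)" using reals_Archimedean2[of "R / e"] less_trans
        by (metis lessI of_nat_less_iff)
      have "x \<in> N t" using x by blast
      then obtain k b where "k \<in> K" "norm b \<le> R / real (Suc t)" "x = k + b"
        by (auto simp: N_def elim!: set_plus_elim)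
      moreover have "R / real (Suc t) < e" using t that by (simp add: field_simps del: of_nat_Suc)
      ultimately show ?thesis by (intro bexI[of _ k]) (auto simp: dist_norm)
    qed
    then have "x \<in> closure K" by (simp add: closure_approachable)
    then show "x \<in> K" using compact_imp_closed[OF K] by simp
  next
    fix x assume "x \<in> K"
    then have "x + 0 \<in> N t" for t unfolding N_def using R(1) by (intro set_plus_intro) auto
    then show "x \<in> (\<Inter>t. N t)" by simp
  qed
  finally have lim: "(\<lambda>t. measure lebesgue (N t)) \<longlonglongrightarrow> measure lebesgue K" .
  have low: "measure lebesgue K \<le> measure lebesgue (K + (*\<^sub>R) (1 / real t) ` L)" for t
  proof -
    have "measure lebesgue ((+) ((1 / real t) *\<^sub>R l) ` K) \<le> measure lebesgue (K + (*\<^sub>R) (1 / real t) ` L)"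
    proof (rule measure_mono_fmeasurable)
      show "(+) ((1 / real t) *\<^sub>R l) ` K \<subseteq> K + (*\<^sub>R) (1 / real t) ` L"
        using l by (auto simp: add.commute[of "_ *\<^sub>R _"])
      show "(+) ((1 / real t) *\<^sub>R l) ` K \<in> sets lebesgue"
        using lmeasurable_compact[OF compact_translation[OF K]] by blast
      show "K + (*\<^sub>R) (1 / real t) ` L \<in> lmeasurable"
        by (rule lmeasurable_compact[OF small_compact])
    qed
    then show ?thesis by (simp only: measure_translation)
  qed
  have up: "measure lebesgue (K + (*\<^sub>R) (1 / real (Suc t)) ` L) \<le> measure lebesgue (N t)" for t
  proof (rule measure_mono_fmeasurable)
    show "K + (*\<^sub>R) (1 / real (Suc t)) ` L \<subseteq> N t" unfolding N_def
      using R(2) by (intro set_plus_mono2 subset_refl) (auto simp: divide_right_mono)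
    show "K + (*\<^sub>R) (1 / real (Suc t)) ` L \<in> sets lebesgue"
      using lmeasurable_compact[OF small_compact] by blast
    show "N t \<in> lmeasurable" by (rule lmeasurable_compact[OF N_compact])
  qed
  have "(\<lambda>t. measure lebesgue (K + (*\<^sub>R) (1 / real (Suc t)) ` L)) \<longlonglongrightarrow> measure lebesgue K"
    by (rule tendsto_sandwich[OF _ _ tendsto_const lim]; intro always_eventually allI low up)
  then show ?thesis by (rule LIMSEQ_imp_Suc)
qed

section \<open>Counting lattice points by unit boxes\<close>

abbreviation integer_vectors :: "(real ^ 'n) set" where
  "integer_vectors \<equiv> {x. \<forall>i. x $ i \<in> \<int>}"

text \<open>Open, so that translates by distinct integer vectors are disjoint; coverings use the
  closed \<open>cbox 0 One\<close>. Both have volume 1.\<close>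

abbreviation unit_box :: "(real ^ 'n) set" where
  "unit_box \<equiv> box 0 One"

lemma One_nth: "(One :: real ^ 'n) $ i = 1"
  unfolding cart_eq_inner_axis by (rule inner_sum_Basis) (simp add: axis_in_Basis_iff)

lemma disjoint_integer_boxes:
  fixes x y :: "real ^ 'n"
  assumes "x \<in> integer_vectors" "y \<in> integer_vectors" "x \<noteq> y"
  shows "(+) x ` unit_box \<inter> (+) y ` unit_box = {}"
proof (rule ccontr)
  assume "(+) x ` unit_box \<inter> (+) y ` unit_box \<noteq> {}"
  then obtain a b where ab: "a \<in> unit_box" "b \<in> unit_box" "x + a = y + b" by auto
  have ab01: "0 < a $ i" "a $ i < 1" "0 < b $ i" "b $ i < 1" for i
    using ab(1,2) by (auto simp: mem_box_cart One_nth simp del: sum_component)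
  have "x $ i = y $ i" for i
  proof -
    obtain m n where mn: "x $ i = of_int m" "y $ i = of_int n" using assms(1,2) by (auto elim!: Ints_cases) (meson Ints_cases)
    have "x $ i + a $ i = y $ i + b $ i" using ab(3) by (metis vector_add_component)
    then have "\<bar>real_of_int m - real_of_int n\<bar> < 1" using ab01[of i] mn by linarith
    then have "m = n" by linarith
    then show ?thesis using mn by simp
  qed
  then show False using assms(3) by (simp add: vec_eq_iff)
qed

text \<open>Each point carries its own unit box. The boxes are disjoint, so their total volume is
  the number of points, and they all lie in the thickened \<open>C\<close>.\<close>

lemma card_integer_points_le:
  fixes F C :: "(real ^ 'n) set"
  assumes F: "finite F" "F \<subseteq> integer_vectors" "F \<subseteq> C" and C: "compact C"
  shows "real (card F) \<le> measure lebesgue (C + cbox 0 One)"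
proof -
  have "measure lebesgue (\<Union>x\<in>F. (+) x ` unit_box) = (\<Sum>x\<in>F. measure lebesgue ((+) x ` (unit_box :: (real ^ 'n) set)))"
  proof (rule measure_UNION'[OF F(1)])
    show "pairwise (\<lambda>x y. disjnt ((+) x ` unit_box) ((+) y ` unit_box)) F"
      unfolding pairwise_def disjnt_def
      by (intro ballI impI disjoint_integer_boxes) (use F(2) in auto)
  qed (simp add: measurable_translation)
  also have "\<dots> = real (card F)" by (simp add: measure_translation)
  finally have "real (card F) = measure lebesgue (\<Union>x\<in>F. (+) x ` unit_box)" by simp
  also have "\<dots> \<le> measure lebesgue (C + cbox 0 One)"
  proof (rule measure_mono_fmeasurable)
    show "(\<Union>x\<in>F. (+) x ` unit_box) \<subseteq> C + cbox 0 One"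
      using F(3) box_subset_cbox[of 0 One] by (auto intro!: set_plus_intro)
    show "(\<Union>x\<in>F. (+) x ` unit_box) \<in> sets lebesgue"
      using F(1) by (intro sets.finite_UN) (auto simp: measurable_translation fmeasurableD)
    show "C + cbox 0 One \<in> lmeasurable" by (intro lmeasurable_compact compact_set_plus C compact_cbox)
  qed
  finally show ?thesis .
qed

lemma measure_le_card_cover:
  fixes F C :: "(real ^ 'n) set"
  assumes F: "finite F" and C: "C \<subseteq> (\<Union>x\<in>F. (+) x ` cbox 0 One)" "C \<in> sets lebesgue"
  shows "measure lebesgue C \<le> real (card F)"
proof -
  have meas: "(+) x ` cbox 0 One \<in> lmeasurable" for x :: "real ^ 'n" by (simp add: measurable_translation)
  have "measure lebesgue C \<le> measure lebesgue (\<Union>x\<in>F. (+) x ` cbox 0 One)"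
    by (rule measure_mono_fmeasurable[OF C]) (intro fmeasurable.finite_UN F meas)
  also have "\<dots> \<le> (\<Sum>x\<in>F. measure lebesgue ((+) x ` (cbox 0 One :: (real ^ 'n) set)))"
    by (rule measure_UNION_le[OF F]) (use meas in blast)
  also have "\<dots> = real (card F)" by (simp add: measure_translation)
  finally show ?thesis .
qed

lemma sum_copies_plus:
  fixes m k :: nat and B :: "'a::comm_monoid_add set"
  shows "(\<Sum>j<m + k. B) = (\<Sum>j<m. B) + (\<Sum>j<k. B)"
  by (induction k) (simp_all add: add.assoc)

lemma scaleR_mem_sum_copies:
  fixes k :: nat and B :: "'a::real_vector set"
  assumes "b \<in> B"
  shows "real k *\<^sub>R b \<in> (\<Sum>j<k. B)"
proof (induction k)
  case (Suc k)
  have "real (Suc k) *\<^sub>R b = real k *\<^sub>R b + b" by (simp add: scaleR_add_left)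
  then show ?case using Suc assms by (auto intro: set_plus_intro)
qed simp

lemma sum_scaleR_mem_sum_copies:
  fixes B :: "'a::real_vector set" and y :: "'i \<Rightarrow> nat"
  assumes "\<And>i. i \<in> I \<Longrightarrow> f i \<in> B"
  shows "(\<Sum>i\<in>I. real (y i) *\<^sub>R f i) \<in> (\<Sum>j<sum y I. B)"
  using assms
proof (induction I rule: infinite_finite_induct)
  case (insert i I)
  then have "real (y i) *\<^sub>R f i + (\<Sum>i\<in>I. real (y i) *\<^sub>R f i) \<in> (\<Sum>j<y i + sum y I. B)"
    unfolding sum_copies_plus by (intro set_plus_intro scaleR_mem_sum_copies) auto
  then show ?case using insert by simp
qed auto

lemma sum_copies_mono:
  fixes m :: nat and A B :: "'a::comm_monoid_add set"
  assumes "A \<subseteq> B"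
  shows "(\<Sum>j<m. A) \<subseteq> (\<Sum>j<m. B)"
  using assms by (induction m) (simp_all add: set_plus_mono2)

lemma sum_copies_integer_vectors:
  fixes m :: nat
  assumes "B \<subseteq> integer_vectors"
  shows "(\<Sum>j<m. B) \<subseteq> (integer_vectors :: (real ^ 'n) set)"
proof (induction m)
  case (Suc m)
  show ?case
  proof
    fix x assume "x \<in> (\<Sum>j<Suc m. B)"
    then obtain a b where "a \<in> (\<Sum>j<m. B)" "b \<in> B" "x = a + b" by (auto elim!: set_plus_elim)
    then show "x \<in> integer_vectors" using Suc assms by (auto intro!: Ints_add)
  qed
qed auto

text \<open>
  Rounding down the coordinates of a point of \<open>t C\<close>, and the coefficients of a representation of that
  point by the elements of \<open>B\<close>, changes the point by a bounded integer vector. Near a fixed multiple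
  of \<open>b0\<close> every such vector is a sum of elements \<open>b0 + axis i 1\<close> and \<open>b0\<close>.
\<close>

lemma card_sum_copies_ge:
  fixes B :: "(real ^ 'n) set"
  assumes B: "finite B" "B \<subseteq> integer_vectors" and b0: "b0 \<in> B" "\<And>i. b0 + axis i 1 \<in> B"
  shows "\<exists>K. \<forall>t. real t ^ CARD('n) * measure lebesgue (convex hull B) \<le> real (card (\<Sum>j<t + K. B))"
proof -
  \<comment> \<open>A bound for the coordinates of the rounding error \<open>q\<close> below: 1 for
    rounding \<open>x\<close>, the sum of the norms for rounding the coefficients, and the last term
    for the at most \<open>card B\<close> copies of \<open>b0\<close> that replace lost
    summands.\<close>
  define R where "R = nat \<lceil>1 + (\<Sum>b\<in>B. norm b) + real (card B) * norm b0\<rceil>"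
  \<comment> \<open>After the shift by \<open>R\<close> each coordinate of the error lies between 0
    and 2 R, so at most 2 R n unit steps are ever needed.\<close>
  define K where "K = 2 * R * CARD('n)"
  define rnd :: "real ^ 'n \<Rightarrow> real ^ 'n" where "rnd x = (\<chi> i. of_int \<lfloor>x $ i\<rfloor>)" for x
  define c where "c = real R *\<^sub>R (\<Sum>i\<in>UNIV. axis i 1) + real K *\<^sub>R b0"
  have R: "1 + (\<Sum>b\<in>B. norm b) + real (card B) * norm b0 \<le> real R" unfolding R_def by linarith
  have mem: "rnd x + c \<in> (\<Sum>j<t + K. B)" if "x \<in> (*\<^sub>R) (real t) ` (convex hull B)" for x t
  proof -
    obtain \<mu> where \<mu>: "\<And>b. b \<in> B \<Longrightarrow> 0 \<le> \<mu> b" "sum \<mu> B = 1" "x = real t *\<^sub>R (\<Sum>b\<in>B. \<mu> b *\<^sub>R b)"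
      using \<open>x \<in> _\<close> unfolding convex_hull_finite[OF B(1)] by auto
    define l where "l = (\<lambda>b. real t * \<mu> b)"
    have l0: "0 \<le> l b" if "b \<in> B" for b using \<mu>(1)[OF that] by (simp add: l_def)
    have l_sum: "sum l B = real t" using \<mu>(2) by (simp add: l_def sum_distrib_left[symmetric])
    have x: "x = (\<Sum>b\<in>B. l b *\<^sub>R b)" using \<mu>(3) by (simp add: l_def scaleR_sum_right)
    define y where "y = (\<lambda>b. nat \<lfloor>l b\<rfloor>)"
    have y: "real (y b) \<le> l b" "l b \<le> real (y b) + 1" if "b \<in> B" for b
      using l0[OF that] by (auto simp: y_def)
    have "(\<Sum>b\<in>B. real (y b)) \<le> real t" unfolding l_sum[symmetric] by (rule sum_mono) (use y in auto)
    then have y_le: "sum y B \<le> t" by (simp flip: of_nat_sum)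
    \<comment> \<open>Rounding down leaves fewer than the prescribed \<open>t\<close> summands;
      \<open>s\<close> copies of \<open>b0\<close> fill the gap.\<close>
    define s where "s = t - sum y B"
    have "real t \<le> (\<Sum>b\<in>B. real (y b) + 1)" unfolding l_sum[symmetric] by (rule sum_mono) (use y in auto)
    then have s_le: "real s \<le> real (card B)" using y_le by (simp add: s_def sum.distrib of_nat_diff)
    define q where "q = rnd x - (\<Sum>b\<in>B. real (y b) *\<^sub>R b) - real s *\<^sub>R b0"
    have q_int: "q $ i \<in> \<int>" for i
      using B(2) b0(1) by (auto simp: q_def rnd_def intro!: Ints_diff Ints_sum Ints_mult)
    have q_bound: "\<bar>q $ i\<bar> \<le> real R" for i
    proof -
      have "q $ i = (of_int \<lfloor>x $ i\<rfloor> - x $ i) + (\<Sum>b\<in>B. (l b - real (y b)) * b $ i) - real s * b0 $ i"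
        by (simp add: q_def rnd_def x left_diff_distrib sum_subtractf)
      moreover have "\<bar>of_int \<lfloor>x $ i\<rfloor> - x $ i\<bar> \<le> 1" by linarith
      moreover have "\<bar>\<Sum>b\<in>B. (l b - real (y b)) * b $ i\<bar> \<le> (\<Sum>b\<in>B. norm b)"
      proof -
        have "\<bar>(l b - real (y b)) * b $ i\<bar> \<le> 1 * norm b" if "b \<in> B" for b
          unfolding abs_mult using y[OF that] component_le_norm_cart[of b i]
          by (intro mult_mono) auto
        then show ?thesis by (intro order_trans[OF sum_abs] sum_mono) simp
      qed
      moreover have "\<bar>real s * b0 $ i\<bar> \<le> real (card B) * norm b0"
        unfolding abs_mult using s_le component_le_norm_cart[of b0 i] by (intro mult_mono) auto
      ultimately show ?thesis using R by linarith
    qed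
    define m where "m = (\<lambda>i. nat \<lfloor>q $ i + real R\<rfloor>)"
    have m: "real (m i) = q $ i + real R" for i
    proof -
      obtain z where "q $ i = of_int z" using q_int[of i] by (auto elim: Ints_cases)
      then show ?thesis using q_bound[of i] by (simp add: m_def)
    qed
    have "real (sum m UNIV) \<le> (\<Sum>i\<in>(UNIV :: 'n set). 2 * real R)"
      unfolding of_nat_sum m using q_bound by (intro sum_mono) (smt (verit, best))
    then have "real (sum m UNIV) \<le> real K" by (simp add: K_def mult.commute)
    then have m_le: "sum m UNIV \<le> K" by (simp only: of_nat_le_iff)
    have q_eq: "q + real R *\<^sub>R (\<Sum>i\<in>UNIV. axis i 1) = (\<Sum>i\<in>UNIV. real (m i) *\<^sub>R axis i 1)"
      unfolding m by (simp add: vec_eq_iff axis_def if_distrib cong: if_cong)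
    have "rnd x + c = (\<Sum>b\<in>B. real (y b) *\<^sub>R b) + real s *\<^sub>R b0
        + (q + real R *\<^sub>R (\<Sum>i\<in>UNIV. axis i 1)) + real K *\<^sub>R b0"
      by (simp add: q_def c_def)
    \<comment> \<open>Each unit step along axis i upgrades one of the \<open>K\<close> reserved
      copies of \<open>b0\<close> to \<open>b0 + axis i 1\<close>; the other reserved copies stay as
      they are, so the number of summands is always \<open>t + K\<close>.\<close>
    also have "\<dots> = (\<Sum>b\<in>B. real (y b) *\<^sub>R b) + real s *\<^sub>R b0
        + (\<Sum>i\<in>UNIV. real (m i) *\<^sub>R (b0 + axis i 1)) + real (K - sum m UNIV) *\<^sub>R b0"
      unfolding q_eq using m_le
      by (simp add: of_nat_diff scaleR_add_right scaleR_diff_left sum.distrib flip: scaleR_sum_left)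
    also have "\<dots> \<in> (\<Sum>j<sum y B + s + sum m UNIV + (K - sum m UNIV). B)"
      unfolding sum_copies_plus using b0
      by (intro set_plus_intro sum_scaleR_mem_sum_copies scaleR_mem_sum_copies) auto
    also have "sum y B + s + sum m UNIV + (K - sum m UNIV) = t + K"
      using y_le m_le by (simp add: s_def)
    finally show ?thesis .
  qed
  have "real t ^ CARD('n) * measure lebesgue (convex hull B) \<le> real (card (\<Sum>j<t + K. B))" for t
  proof -
    let ?C = "(*\<^sub>R) (real t) ` (convex hull B)"
    \<comment> \<open>The shift \<open>c\<close> depends on neither \<open>x\<close> nor
      \<open>t\<close>, so the sumset has at least as many elements as there are rounded points, and
      the unit boxes at the rounded points cover \<open>?C\<close>.\<close>
    have sub: "(\<lambda>z. z + c) ` rnd ` ?C \<subseteq> (\<Sum>j<t + K. B)" using mem by blast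
    have fin: "finite (\<Sum>j<t + K. B)" by (intro finite_set_sum ballI B(1))
    have inj: "inj_on (\<lambda>z. z + c) (rnd ` ?C)" by (auto simp: inj_on_def)
    have fin_rnd: "finite (rnd ` ?C)" using finite_subset[OF sub fin] inj by (rule finite_imageD)
    have "real t ^ CARD('n) * measure lebesgue (convex hull B) = measure lebesgue ?C"
      by (simp add: measure_scaleR)
    also have "\<dots> \<le> real (card (rnd ` ?C))"
    proof (rule measure_le_card_cover[OF fin_rnd])
      show "?C \<subseteq> (\<Union>x\<in>rnd ` ?C. (+) x ` cbox 0 One)"
      proof
        fix x assume x: "x \<in> ?C"
        have "x - rnd x \<in> cbox 0 One"
          by (auto simp: mem_box_cart One_nth rnd_def simp del: sum_component) linarith
        then have "x \<in> (+) (rnd x) ` cbox 0 One" by (rule image_eqI[rotated]) simp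
        then show "x \<in> (\<Union>x\<in>rnd ` ?C. (+) x ` cbox 0 One)" using x by blast
      qed
      show "?C \<in> sets lebesgue"
        using B(1) by (intro fmeasurableD lmeasurable_compact compact_scaling finite_imp_compact_convex_hull)
    qed
    also have "\<dots> \<le> real (card (\<Sum>j<t + K. B))"
      using card_mono[OF fin sub] by (simp add: card_image[OF inj])
    finally show ?thesis .
  qed
  then show ?thesis by blast
qed

text \<open>Dividing by t^n shrinks the unit thickening to size 1 / t, which is the situation of
  \<open>tendsto_measure_plus_small\<close>.\<close>

lemma card_sum_copies_le:
  fixes B :: "(real ^ 'n) set"
  assumes B: "finite B" "B \<subseteq> integer_vectors" "B \<noteq> {}" and t: "0 < t"
  shows "real (card (\<Sum>j<t. B)) / real t ^ CARD('n)
    \<le> measure lebesgue (convex hull B + (*\<^sub>R) (1 / real t) ` cbox 0 One)"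
proof -
  let ?C = "convex hull B"
  have "(\<Sum>j<t. B) \<subseteq> (\<Sum>j<t. ?C)" by (intro sum_copies_mono hull_subset)
  also have "\<dots> = (*\<^sub>R) (real t) ` ?C" using B(3) by (intro sum_copies_convex) auto
  finally have "real (card (\<Sum>j<t. B)) \<le> measure lebesgue ((*\<^sub>R) (real t) ` ?C + cbox 0 One)"
    using B by (intro card_integer_points_le finite_set_sum ballI sum_copies_integer_vectors
      compact_scaling finite_imp_compact_convex_hull)
  also have "(*\<^sub>R) (real t) ` ?C + cbox 0 One = (*\<^sub>R) (real t) ` (?C + (*\<^sub>R) (1 / real t) ` cbox 0 One)"
    (is "?l = ?r")
  proof (intro equalityI subsetI)
    fix z assume "z \<in> ?l"
    then obtain a b where ab: "a \<in> ?C" "b \<in> cbox 0 One" "z = real t *\<^sub>R a + b" by (auto elim!: set_plus_elim)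
    then have "z = real t *\<^sub>R (a + (1 / real t) *\<^sub>R b)" using t by (simp add: scaleR_add_right)
    then show "z \<in> ?r" using ab by blast
  next
    fix z assume "z \<in> ?r"
    then obtain a b where ab: "a \<in> ?C" "b \<in> cbox 0 One" "z = real t *\<^sub>R (a + (1 / real t) *\<^sub>R b)"
      by (auto elim!: set_plus_elim)
    then have "z = real t *\<^sub>R a + b" using t by (simp add: scaleR_add_right)
    then show "z \<in> ?l" using ab by blast
  qed
  finally show ?thesis using t by (simp add: measure_scaleR field_simps)
qed

text \<open>The simplex at \<open>b0\<close> is what makes the law hold: in dimension one, B = {0,
  2} has t + 1 sums of t elements, while its hull has length 2.\<close>

theorem tendsto_card_sum_copies:
  fixes B :: "(real ^ 'n) set"
  assumes B: "finite B" "B \<subseteq> integer_vectors" and b0: "b0 \<in> B" "\<And>i. b0 + axis i 1 \<in> B"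
  shows "(\<lambda>t. real (card (\<Sum>j<t. B)) / real t ^ CARD('n)) \<longlonglongrightarrow> measure lebesgue (convex hull B)"
proof -
  let ?V = "measure lebesgue (convex hull B)"
  obtain K where K: "\<And>t. real t ^ CARD('n) * ?V \<le> real (card (\<Sum>j<t + K. B))"
    using card_sum_copies_ge[OF B b0] by blast
  have "(\<lambda>t. ((1 - real K * (1 / real t)) ^ CARD('n)) * ?V) \<longlonglongrightarrow> (1 - real K * 0) ^ CARD('n) * ?V"
    by (intro tendsto_intros lim_1_over_n)
  then have lo: "(\<lambda>t. ((1 - real K * (1 / real t)) ^ CARD('n)) * ?V) \<longlonglongrightarrow> ?V" by simp
  have hi: "(\<lambda>t. measure lebesgue (convex hull B + (*\<^sub>R) (1 / real t) ` cbox 0 One)) \<longlonglongrightarrow> ?V"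
    using B(1) by (intro tendsto_measure_plus_small finite_imp_compact_convex_hull compact_cbox) auto
  show ?thesis
  proof (rule tendsto_sandwich[OF _ _ lo hi])
    show "\<forall>\<^sub>F t in sequentially. (1 - real K * (1 / real t)) ^ CARD('n) * ?V
        \<le> real (card (\<Sum>j<t. B)) / real t ^ CARD('n)"
      using eventually_gt_at_top[of "K"]
    proof eventually_elim
      case (elim t)
      \<comment> \<open>The lower bound is applied to \<open>t - K\<close>; the loss is the factor
        (1 - K / t)^n, which tends to 1.\<close>
      have "(1 - real K * (1 / real t)) = real (t - K) / real t" using elim by (simp add: field_simps of_nat_diff)
      then have "(1 - real K * (1 / real t)) ^ CARD('n) * ?V = real (t - K) ^ CARD('n) * ?V / real t ^ CARD('n)"
        by (simp add: power_divide)
      also have "\<dots> \<le> real (card (\<Sum>j<t. B)) / real t ^ CARD('n)"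
        using K[of "t - K"] elim by (intro divide_right_mono) auto
      finally show ?case .
    qed
    show "\<forall>\<^sub>F t in sequentially. real (card (\<Sum>j<t. B)) / real t ^ CARD('n)
        \<le> measure lebesgue (convex hull B + (*\<^sub>R) (1 / real t) ` cbox 0 One)"
      using eventually_gt_at_top[of 0] by eventually_elim (use card_sum_copies_le[OF B] b0 in auto)
  qed
qed

subsection \<open>Monomial ideals\<close>

interpretation ideals: module "(*) :: 'a \<Rightarrow> 'a \<Rightarrow> 'a::comm_ring_1"
  by standard (simp_all add: algebra_simps)

text \<open>Here it reads \<open>a * (b * x) = (a * b) * x\<close> and would work against
  \<open>mult.assoc\<close>.\<close>

declare ideals.scale_scale [simp del]

text \<open>Lets an ideal inside an elementwise product be replaced by its generators. The
  congruence lemmas that follow extend this to powers and finite products, so that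
  \<open>ideal_power_product\<close> is generated by products of monomials.\<close>

lemma ideal_gen_times:
  fixes S T :: "'a::comm_ring_1 set"
  shows "ideal_gen (ideal_gen S * T) = ideal_gen (S * T)"
proof (rule antisym)
  have "x * t \<in> ideal_gen (S * T)" if "x \<in> ideal_gen S" "t \<in> T" for x t
    using that(1)
  proof (induction rule: ideals.span_induct_alt)
    case base
    show ?case by (simp add: ideals.span_zero)
  next
    case (step c x y)
    have "c * (x * t) \<in> ideal_gen (S * T)"
      by (rule ideals.span_scale, rule ideals.span_base, rule set_times_intro[OF step(1) that(2)])
    from ideals.span_add[OF this step(2)] show ?case by (simp add: distrib_right mult.assoc)
  qed
  then have "ideal_gen S * T \<subseteq> ideal_gen (S * T)" by (auto elim!: set_times_elim)
  then show "ideal_gen (ideal_gen S * T) \<subseteq> ideal_gen (S * T)"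
    by (rule ideals.span_minimal) (rule ideals.subspace_span)
  show "ideal_gen (S * T) \<subseteq> ideal_gen (ideal_gen S * T)"
    by (intro ideals.span_mono set_times_mono2 ideals.span_superset subset_refl)
qed

lemma ideal_gen_times_cong:
  fixes S S' T T' :: "'a::comm_ring_1 set"
  assumes "ideal_gen S = ideal_gen S'" "ideal_gen T = ideal_gen T'"
  shows "ideal_gen (S * T) = ideal_gen (S' * T')"
proof -
  have "ideal_gen (S * T) = ideal_gen (S' * T)" for T :: "'a set"
    using ideal_gen_times[of S] ideal_gen_times[of S'] assms(1) by metis
  moreover have "ideal_gen (S' * T) = ideal_gen (S' * T')"
    using ideal_gen_times[of T S'] ideal_gen_times[of T' S'] assms(2) by (metis mult.commute)
  ultimately show ?thesis by simp
qed

lemma ideal_gen_power_cong: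
  fixes S S' :: "'a::comm_ring_1 set"
  assumes "ideal_gen S = ideal_gen S'"
  shows "ideal_gen (S ^ k) = ideal_gen (S' ^ k)"
proof (induction k)
  case (Suc k)
  show ?case unfolding power_Suc by (rule ideal_gen_times_cong[OF assms Suc.IH])
qed simp

lemma ideal_gen_prod_cong:
  fixes S S' :: "'i \<Rightarrow> 'a::comm_ring_1 set"
  assumes "\<And>i. ideal_gen (S i) = ideal_gen (S' i)"
  shows "ideal_gen (\<Prod>i\<in>I. S i) = ideal_gen (\<Prod>i\<in>I. S' i)"
proof (induction I rule: infinite_finite_induct)
  case (insert i I)
  show ?case unfolding prod.insert[OF insert.hyps] by (rule ideal_gen_times_cong[OF assms insert.IH])
qed simp_all

text \<open>Stated by divisibility of the terms, so that membership is decided term by term;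
  \<open>ideal_gen_monomials\<close> identifies it with the generated ideal.\<close>

definition monomial_ideal :: "'v monomial set \<Rightarrow> ('v, 'k::comm_ring_1) mpoly set" where
  "monomial_ideal E = {f. \<forall>a\<in>Poly_Mapping.keys f. \<exists>e\<in>E. \<exists>b. a = e + b}"

lemma monomial_ideal_mono: "E \<subseteq> F \<Longrightarrow> monomial_ideal E \<subseteq> monomial_ideal F"
  unfolding monomial_ideal_def by blast

lemma poly_of_monomial_add:
  "poly_of_monomial (a + b) = poly_of_monomial a * poly_of_monomial b"
  by (simp add: poly_of_monomial_def mult_single)

lemma poly_of_monomial_0: "poly_of_monomial 0 = 1"
  by (simp add: poly_of_monomial_def)

lemma poly_of_monomial_image_plus:
  "poly_of_monomial ` (E + F) = poly_of_monomial ` E * poly_of_monomial ` F"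
  unfolding set_plus_image set_times_image
  by (force simp: image_iff poly_of_monomial_add)

lemma poly_of_monomial_image_sum:
  "poly_of_monomial ` (\<Sum>i\<in>I. E i) = (\<Prod>i\<in>I. poly_of_monomial ` E i)"
  by (induction I rule: infinite_finite_induct)
    (simp_all add: poly_of_monomial_image_plus poly_of_monomial_0)

lemma subspace_monomial_ideal: "ideals.subspace (monomial_ideal E)"
proof (rule ideals.subspaceI)
  show "0 \<in> monomial_ideal E" by (simp add: monomial_ideal_def)
  show "x + y \<in> monomial_ideal E" if "x \<in> monomial_ideal E" "y \<in> monomial_ideal E" for x y
    using that Poly_Mapping.keys_add[of x y] unfolding monomial_ideal_def by blast
  show "c * x \<in> monomial_ideal E" if "x \<in> monomial_ideal E" for c x
  proof -
    have "\<exists>e\<in>E. \<exists>b. a = e + b" if a: "a \<in> Poly_Mapping.keys (c * x)" for a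
    proof -
      obtain a1 a2 where "a = a1 + a2" "a2 \<in> Poly_Mapping.keys x" using keys_mult[of c x] a by blast
      moreover obtain e b where "e \<in> E" "a2 = e + b"
        using calculation(2) \<open>x \<in> monomial_ideal E\<close> unfolding monomial_ideal_def by blast
      ultimately show ?thesis by (metis add.assoc add.commute)
    qed
    then show ?thesis by (simp add: monomial_ideal_def)
  qed
qed

lemma mpoly_eq_sum_single:
  "(\<Sum>a\<in>Poly_Mapping.keys f. Poly_Mapping.single a (Poly_Mapping.lookup f a)) = f"
  by (rule poly_mapping_eqI)
    (simp add: lookup_sum lookup_single when_def in_keys_iff)

lemma ideal_gen_monomials:
  "ideal_gen (poly_of_monomial ` E) = (monomial_ideal E :: ('v, 'k::comm_ring_1) mpoly set)"
proof (rule antisym)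
  have "poly_of_monomial ` E \<subseteq> (monomial_ideal E :: ('v, 'k) mpoly set)"
    by (auto simp: monomial_ideal_def poly_of_monomial_def) (metis add.right_neutral)
  then show "ideal_gen (poly_of_monomial ` E) \<subseteq> (monomial_ideal E :: ('v, 'k) mpoly set)"
    by (rule ideals.span_minimal) (rule subspace_monomial_ideal)
  show "(monomial_ideal E :: ('v, 'k) mpoly set) \<subseteq> ideal_gen (poly_of_monomial ` E)"
  proof
    fix f :: "('v, 'k) mpoly" assume f: "f \<in> monomial_ideal E"
    have "Poly_Mapping.single a (Poly_Mapping.lookup f a) \<in> ideal_gen (poly_of_monomial ` E)"
      if a: "a \<in> Poly_Mapping.keys f" for a
    proof -
      obtain e b where eb: "e \<in> E" "a = e + b" using f a unfolding monomial_ideal_def by blast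
      have "Poly_Mapping.single a (Poly_Mapping.lookup f a) = Poly_Mapping.single b (Poly_Mapping.lookup f a) * poly_of_monomial e"
        by (simp add: poly_of_monomial_def mult_single eb add.commute)
      then show ?thesis using eb(1) by (simp add: ideals.span_scale ideals.span_base)
    qed
    then have "(\<Sum>a\<in>Poly_Mapping.keys f. Poly_Mapping.single a (Poly_Mapping.lookup f a)) \<in> ideal_gen (poly_of_monomial ` E)"
      by (rule ideals.span_sum)
    then show "f \<in> ideal_gen (poly_of_monomial ` E)" by (simp only: mpoly_eq_sum_single)
  qed
qed

definition variables :: "'v monomial set" where
  "variables = {Poly_Mapping.single v 1 | v. True}"

definition exponent_sumset :: "('n::finite \<Rightarrow> 'n option monomial set) \<Rightarrow> ('n option \<Rightarrow> nat) \<Rightarrow> 'n option monomial set" where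
  "exponent_sumset M u = (\<Sum>v\<in>UNIV. \<Sum>j<u v. case v of None \<Rightarrow> variables | Some i \<Rightarrow> M i)"

lemma exponent_sumset_eq:
  "exponent_sumset M u = (\<Sum>j<u None. variables) + (\<Sum>i\<in>UNIV. \<Sum>j<u (Some i). M i)"
  by (simp add: exponent_sumset_def UNIV_option_conv sum.reindex)

text \<open>Consequently R_u is the quotient of the ideal of a finite homogeneous set E by the ideal
  of \<open>E + variables\<close>.\<close>

lemma exponent_sumset_Suc:
  "exponent_sumset M (u(None := u None + 1)) = exponent_sumset M u + variables"
  by (simp add: exponent_sumset_eq ac_simps)

lemma ideal_power_product_eq:
  fixes J :: "'n::finite \<Rightarrow> ('n option, 'k::comm_ring_1) mpoly set"
  assumes "\<And>i. J i = ideal_gen (poly_of_monomial ` M i)"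
  shows "ideal_power_product max_graded_ideal J u = monomial_ideal (exponent_sumset M u)"
proof -
  have m: "max_graded_ideal = ideal_gen (poly_of_monomial ` (variables :: 'n option monomial set) :: ('n option, 'k) mpoly set)"
    unfolding max_graded_ideal_def variables_def by (rule arg_cong[where f = ideal_gen]) auto
  have "ideal_power_product max_graded_ideal J u
      = ideal_gen ((poly_of_monomial ` variables) ^ u None * (\<Prod>i\<in>UNIV. (poly_of_monomial ` M i) ^ u (Some i)))"
    unfolding ideal_power_product_def m assms
    by (intro ideal_gen_times_cong ideal_gen_prod_cong ideal_gen_power_cong ideals.span_span)
  also have "\<dots> = ideal_gen (poly_of_monomial ` exponent_sumset M u)"
    by (simp only: exponent_sumset_eq poly_of_monomial_image_plus poly_of_monomial_image_sum prod_constant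
        card_lessThan)
  finally show ?thesis by (simp only: ideal_gen_monomials)
qed

subsection \<open>Length of quotients of monomial ideals\<close>

lemma mon_degree_add: "mon_degree (a + b) = mon_degree a + mon_degree b"
  by (simp add: mon_degree_def lookup_add sum.distrib)

lemma mon_degree_variable: "a \<in> variables \<Longrightarrow> mon_degree a = 1"
  by (auto simp: variables_def mon_degree_def lookup_single when_def)

lemma mon_degree_eq_0_iff: "mon_degree a = 0 \<longleftrightarrow> a = 0"
  by (auto simp: mon_degree_def intro: poly_mapping_eqI)

lemma nonzero_monomial_variable_factor:
  assumes "b \<noteq> 0"
  obtains x c where "x \<in> variables" "b = x + c"
proof -
  obtain v where v: "Poly_Mapping.lookup b v \<noteq> 0" using assms by (metis lookup_zero poly_mapping_eqI)
  have "b = Poly_Mapping.single v 1 + (b - Poly_Mapping.single v 1)"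
    using v by (intro poly_mapping_eqI) (auto simp: lookup_add lookup_minus lookup_single when_def)
  then show thesis using that unfolding variables_def by blast
qed

lemma coset_eq_iff:
  assumes "ideals.subspace L"
  shows "x +o L = y +o L \<longleftrightarrow> x - y \<in> L"
proof
  assume eq: "x +o L = y +o L"
  have "x + 0 \<in> x +o L" by (intro set_plus_intro2 ideals.subspace_0 assms)
  then show "x - y \<in> L" unfolding eq by (simp add: set_plus_imp_minus)
next
  have *: "x +o L \<subseteq> y +o L" if "x - y \<in> L" for x y
  proof
    fix z assume "z \<in> x +o L"
    then have "z - x \<in> L" by (rule set_plus_imp_minus)
    from ideals.subspace_add[OF assms this that] show "z \<in> y +o L" by (simp add: set_minus_plus)
  qed
  assume "x - y \<in> L"
  then show "x +o L = y +o L" using *[of x y] *[of y x] ideals.subspace_neg[OF assms, of "x - y"] by auto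
qed

lemma coset_mem_image_iff:
  assumes "ideals.subspace L" "ideals.subspace W" "L \<subseteq> W"
  shows "x +o L \<in> (\<lambda>x. x +o L) ` W \<longleftrightarrow> x \<in> W"
proof
  assume "x +o L \<in> (\<lambda>x. x +o L) ` W"
  then obtain w where w: "w \<in> W" "x - w \<in> L" using coset_eq_iff[OF assms(1)] by auto
  then show "x \<in> W" using ideals.subspace_add[OF assms(2), of w "x - w"] assms(3) by auto
qed auto

lemma coset_add:
  assumes "ideals.subspace L"
  shows "(x +o L) + (y +o L) = (x + y) +o L"
proof -
  have "L + L = L"
    using ideals.subspace_add[OF assms] set_zero_plus2[OF ideals.subspace_0[OF assms], of L]
    by (auto elim!: set_plus_elim)
  then show ?thesis by (simp add: set_plus_rearrange)
qed

lemma quotient_submodule_image: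
  assumes L: "ideals.subspace L" and W: "ideals.subspace W" "L \<subseteq> W" "W \<subseteq> N"
  shows "quotient_submodule N L ((\<lambda>x. x +o L) ` W)"
  unfolding quotient_submodule_def quotient_module_def
proof (intro conjI ballI allI impI)
  show "(\<lambda>x. x +o L) ` W \<subseteq> (\<lambda>x. x +o L) ` N" using W(3) by blast
  show "L \<in> (\<lambda>x. x +o L) ` W" using ideals.subspace_0[OF W(1)] by (metis image_eqI set_zero_plus)
  show "X + Y \<in> (\<lambda>x. x +o L) ` W" if "X \<in> (\<lambda>x. x +o L) ` W" "Y \<in> (\<lambda>x. x +o L) ` W" for X Y
    using that ideals.subspace_add[OF W(1)] by (auto simp: coset_add[OF L])
  show "(a * x) +o L \<in> (\<lambda>x. x +o L) ` W" if "x +o L \<in> (\<lambda>x. x +o L) ` W" for a x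
    using that ideals.subspace_scale[OF W(1)] by (simp add: coset_mem_image_iff[OF L W(1,2)])
qed

text \<open>Scalars act as constant polynomials. Every submodule is thus also a k-subspace, and
  lengths can be bounded by dimensions.\<close>

interpretation mpoly_space: vector_space
  "\<lambda>(c :: 'k::field) (f :: ('v, 'k) mpoly). Poly_Mapping.single 0 c * f"
proof
  fix a b :: 'k and x :: "('v, 'k) mpoly"
  show "Poly_Mapping.single 0 (a + b) * x = Poly_Mapping.single 0 a * x + Poly_Mapping.single 0 b * x"
    by (simp add: single_add distrib_right)
  show "Poly_Mapping.single 0 a * (Poly_Mapping.single 0 b * x) = Poly_Mapping.single 0 (a * b) * x"
    by (simp add: mult_single flip: mult.assoc)
  show "Poly_Mapping.single 0 1 * x = x" by simp
qed (simp add: distrib_left)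

context
  fixes E :: "'v::finite monomial set" and d :: nat
  assumes fin: "finite E" and deg: "\<And>e. e \<in> E \<Longrightarrow> mon_degree e = d"
begin

abbreviation (input) upper_ideal :: "('v, 'k::field) mpoly set" where
  "upper_ideal \<equiv> monomial_ideal (E + variables)"

text \<open>Terms of the upper ideal have degree greater than \<open>d\<close>. Conversely, in
  \<open>mem_upper_idealI\<close>, a multiple of an element of \<open>E\<close> that is not in
  \<open>E\<close> has a nontrivial cofactor, hence one divisible by a variable. Together: modulo
  \<open>upper_ideal\<close>, an element of \<open>monomial_ideal E\<close> is determined by its
  coefficients on \<open>E\<close>.\<close>

lemma keys_upper_ideal:
  assumes "f \<in> upper_ideal"
  shows "Poly_Mapping.keys f \<inter> E = {}"
proof -
  have False if a: "a \<in> Poly_Mapping.keys f" "a \<in> E" for a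
  proof -
    obtain e x b where "e \<in> E" "x \<in> variables" "a = e + x + b"
      using assms a(1) unfolding monomial_ideal_def set_plus_def by blast
    then have "mon_degree a = d + 1 + mon_degree b" using deg by (simp add: mon_degree_add mon_degree_variable)
    then show False using deg[OF a(2)] by simp
  qed
  then show ?thesis by blast
qed

lemma mem_upper_idealI:
  assumes "f \<in> monomial_ideal E" "Poly_Mapping.keys f \<inter> E = {}"
  shows "f \<in> upper_ideal"
  unfolding monomial_ideal_def
proof (intro CollectI ballI)
  fix a assume a: "a \<in> Poly_Mapping.keys f"
  then obtain e b where eb: "e \<in> E" "a = e + b" using assms(1) unfolding monomial_ideal_def by blast
  then have "b \<noteq> 0" using a assms(2) by auto
  then obtain x c where "x \<in> variables" "b = x + c" by (rule nonzero_monomial_variable_factor)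
  then show "\<exists>e\<in>E + variables. \<exists>b. a = e + b"
    using eb by (intro bexI[of _ "e + x"] exI[of _ c]) (auto simp: add.assoc)
qed

lemma monomial_ideal_between:
  assumes "G \<subseteq> E"
  shows "upper_ideal \<subseteq> monomial_ideal (E + variables \<union> G)"
    and "monomial_ideal (E + variables \<union> G) \<subseteq> monomial_ideal E"
proof -
  show "upper_ideal \<subseteq> monomial_ideal (E + variables \<union> G)" by (intro monomial_ideal_mono) auto
  have "\<exists>e\<in>E. \<exists>b. a = e + b" if g: "g \<in> E + variables \<union> G" "a = g + c" for a g c
  proof (cases "g \<in> G")
    case False
    then obtain e x where "e \<in> E" "x \<in> variables" "g = e + x" using g(1) unfolding set_plus_def by blast
    then show ?thesis using g(2) by (metis add.assoc)
  qed (use g assms in blast)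
  then show "monomial_ideal (E + variables \<union> G) \<subseteq> monomial_ideal E"
    unfolding monomial_ideal_def by blast
qed

text \<open>The elements of \<open>E\<close> are adjoined one at a time. Each step is strict,
  because a monomial of degree \<open>d\<close> is neither a proper multiple of another one of that
  degree nor in the upper ideal.\<close>

lemma quotient_chain_exists:
  "\<exists>c :: nat \<Rightarrow> ('v, 'k::field) mpoly set set.
     (\<forall>i\<le>card E. quotient_submodule (monomial_ideal E) upper_ideal (c i)) \<and>
     (\<forall>i<card E. c i \<subset> c (Suc i))"
proof -
  obtain h where h: "bij_betw h {0..<card E} E" using ex_bij_betw_nat_finite[OF fin] by blast
  define W :: "nat \<Rightarrow> ('v, 'k) mpoly set" where "W = (\<lambda>i. monomial_ideal (E + variables \<union> h ` {0..<i}))"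
  define c where "c = (\<lambda>i. (\<lambda>x. x +o upper_ideal) ` W i)"
  have sub: "h ` {0..<i} \<subseteq> E" if "i \<le> card E" for i
    using that bij_betw_imp_surj_on[OF h] by auto
  have "quotient_submodule (monomial_ideal E) upper_ideal (c i)" if "i \<le> card E" for i
    unfolding c_def W_def using monomial_ideal_between[OF sub[OF that]]
    by (intro quotient_submodule_image subspace_monomial_ideal)
  moreover have "c i \<subset> c (Suc i)" if i: "i < card E" for i
  proof (rule psubsetI)
    have "W i \<subseteq> W (Suc i)" unfolding W_def by (intro monomial_ideal_mono Un_mono image_mono) auto
    then show "c i \<subseteq> c (Suc i)" by (auto simp: c_def)
    let ?p = "poly_of_monomial (h i) :: ('v, 'k) mpoly"
    have keys: "Poly_Mapping.keys ?p = {h i}" by (simp add: poly_of_monomial_def)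
    have hi: "h i \<in> E" using i bij_betw_imp_surj_on[OF h] by auto
    have mem: "?p +o upper_ideal \<in> c j \<longleftrightarrow> ?p \<in> W j" if "j \<le> card E" for j
      unfolding c_def W_def using monomial_ideal_between(1)[OF sub[OF that]]
      by (intro coset_mem_image_iff subspace_monomial_ideal)
    have "?p \<in> W (Suc i)" unfolding W_def monomial_ideal_def mem_Collect_eq keys
      by (intro ballI bexI[of _ "h i"] exI[of _ 0]) auto
    moreover have "?p \<notin> W i"
    proof
      assume "?p \<in> W i"
      then obtain g b where g: "g \<in> E + variables \<union> h ` {0..<i}" "h i = g + b"
        unfolding W_def monomial_ideal_def mem_Collect_eq keys by blast
      show False
      proof (cases "g \<in> h ` {0..<i}")
        case True
        then obtain j where j: "j < i" "g = h j" by auto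
        then have "h j \<in> E" using i bij_betw_imp_surj_on[OF h] by auto
        then have "mon_degree b = 0" using deg[OF hi] deg[of "h j"] g(2) j(2) by (simp add: mon_degree_add)
        then have "h i = h j" using g(2) j(2) by (simp add: mon_degree_eq_0_iff)
        then show False using inj_onD[OF bij_betw_imp_inj_on[OF h], of i j] i j(1) by auto
      next
        case False
        then have "?p \<in> upper_ideal" unfolding monomial_ideal_def mem_Collect_eq keys using g by blast
        then show False using keys_upper_ideal hi keys by blast
      qed
    qed
    ultimately show "c i \<noteq> c (Suc i)" using mem[of i] mem[of "Suc i"] i by auto
  qed
  ultimately show ?thesis by blast
qed

text \<open>Each strict inclusion yields a new vector in the k-span of the monomials of
  \<open>E\<close>. The preimages \<open>W i\<close> are k-subspaces, so a vector outside
  \<open>W i\<close> is independent of those chosen before, and their number is bounded by the size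
  of the spanning set.\<close>

lemma quotient_chain_bound:
  fixes c :: "nat \<Rightarrow> ('v, 'k::field) mpoly set set"
  assumes sub: "\<And>i. i \<le> r \<Longrightarrow> quotient_submodule (monomial_ideal E) upper_ideal (c i)"
    and strict: "\<And>i. i < r \<Longrightarrow> c i \<subset> c (Suc i)"
  shows "r \<le> card E"
proof -
  let ?L = "upper_ideal :: ('v, 'k) mpoly set"
  let ?P = "poly_of_monomial ` E :: ('v, 'k) mpoly set"
  define W where "W = (\<lambda>i. {x. x +o ?L \<in> c i})"
  have L: "ideals.subspace ?L" by (rule subspace_monomial_ideal)
  have W_sub: "mpoly_space.subspace (W i)" if "i \<le> r" for i
    using sub[OF that] unfolding W_def quotient_submodule_def
    by (intro mpoly_space.subspaceI) (auto simp flip: coset_add[OF L])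
  have "\<exists>g \<in> mpoly_space.span ?P. g \<in> W (Suc i) - W i" if i: "i < r" for i
  proof -
    obtain X where X: "X \<in> c (Suc i)" "X \<notin> c i" using strict[OF i] by blast
    then obtain x where x: "x \<in> monomial_ideal E" "X = x +o ?L"
      using sub[of "Suc i"] i by (auto simp: quotient_submodule_def quotient_module_def)
    \<comment> \<open>\<open>x\<close> truncated to its terms in \<open>E\<close>; the rest lies in
      \<open>upper_ideal\<close>, so the coset is unchanged.\<close>
    define g where "g = (\<Sum>a\<in>E. Poly_Mapping.single a (Poly_Mapping.lookup x a))"
    have "Poly_Mapping.single a (Poly_Mapping.lookup x a) = Poly_Mapping.single 0 (Poly_Mapping.lookup x a) * poly_of_monomial a" for a
      by (simp add: poly_of_monomial_def mult_single)
    then have g_span: "g \<in> mpoly_space.span ?P" unfolding g_def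
      by (intro mpoly_space.span_sum) (simp add: mpoly_space.span_scale mpoly_space.span_base)
    have lookup_g: "Poly_Mapping.lookup g a = (if a \<in> E then Poly_Mapping.lookup x a else 0)" for a
      using fin by (simp add: g_def lookup_sum lookup_single when_def)
    have keys: "Poly_Mapping.keys (x - g) \<subseteq> Poly_Mapping.keys x - E"
      by (auto simp: in_keys_iff lookup_minus lookup_g split: if_splits)
    then have "x - g \<in> monomial_ideal E" using x(1) unfolding monomial_ideal_def by blast
    then have "x - g \<in> ?L" using keys by (intro mem_upper_idealI) auto
    then have "x +o ?L = g +o ?L" by (simp add: coset_eq_iff[OF L])
    then show ?thesis using g_span X x(2) unfolding W_def by auto
  qed
  then obtain g where g: "\<And>i. i < r \<Longrightarrow> g i \<in> mpoly_space.span ?P \<and> g i \<in> W (Suc i) - W i" by metis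
  have "mpoly_space.independent (g ` {..<j}) \<and> card (g ` {..<j}) = j \<and> g ` {..<j} \<subseteq> W j" if "j \<le> r" for j
    using that
  proof (induction j)
    case 0
    then show ?case by (simp add: mpoly_space.independent_empty)
  next
    case (Suc j)
    then have IH: "mpoly_space.independent (g ` {..<j})" "card (g ` {..<j}) = j" "g ` {..<j} \<subseteq> W j" by auto
    have j: "j < r" using Suc.prems by simp
    have "mpoly_space.span (g ` {..<j}) \<subseteq> W j"
      using IH(3) W_sub[of j] j by (intro mpoly_space.span_minimal) auto
    then have nin: "g j \<notin> mpoly_space.span (g ` {..<j})" using g[OF j] by blast
    have new: "g j \<notin> g ` {..<j}" using nin mpoly_space.span_base[of "g j" "g ` {..<j}"] by metis
    have "W j \<subseteq> W (Suc j)" using strict[OF j] unfolding W_def by blast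
    then have "g ` {..<Suc j} \<subseteq> W (Suc j)" using IH(3) g[OF j] unfolding lessThan_Suc by blast
    moreover have "card (g ` {..<Suc j}) = Suc j" using IH(2) new by (simp add: lessThan_Suc)
    moreover have "mpoly_space.independent (g ` {..<Suc j})"
      unfolding lessThan_Suc image_insert by (rule mpoly_space.independent_insertI[OF nin IH(1)])
    ultimately show ?case by blast
  qed
  from this[of r] have "mpoly_space.independent (g ` {..<r})" "card (g ` {..<r}) = r" by auto
  moreover have "g ` {..<r} \<subseteq> mpoly_space.span ?P" using g by auto
  ultimately have "r \<le> card ?P" using mpoly_space.independent_span_bound[of ?P "g ` {..<r}"] fin by auto
  also have "\<dots> \<le> card E" by (rule card_image_le[OF fin])
  finally show ?thesis .
qed

theorem quotient_length_monomial_ideals: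
  "quotient_length (monomial_ideal E :: ('v, 'k::field) mpoly set) upper_ideal = enat (card E)"
  unfolding quotient_length_def
proof (rule antisym)
  show "Sup {enat r |r. \<exists>c :: nat \<Rightarrow> ('v, 'k) mpoly set set.
      (\<forall>i\<le>r. quotient_submodule (monomial_ideal E) upper_ideal (c i)) \<and> (\<forall>i<r. c i \<subset> c (Suc i))}
    \<le> enat (card E)"
  proof (rule Sup_least, elim CollectE exE conjE)
    fix x r and c :: "nat \<Rightarrow> ('v, 'k) mpoly set set"
    assume "x = enat r" "\<forall>i\<le>r. quotient_submodule (monomial_ideal E) upper_ideal (c i)"
      "\<forall>i<r. c i \<subset> c (Suc i)"
    then show "x \<le> enat (card E)" using quotient_chain_bound[of r c] by simp
  qed
  show "enat (card E) \<le> Sup {enat r |r. \<exists>c :: nat \<Rightarrow> ('v, 'k) mpoly set set.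
      (\<forall>i\<le>r. quotient_submodule (monomial_ideal E) upper_ideal (c i)) \<and> (\<forall>i<r. c i \<subset> c (Suc i))}"
    by (rule Sup_upper, intro CollectI exI[of _ "card E"] conjI refl quotient_chain_exists)
qed

end

subsection \<open>Mixed multiplicities as mixed volumes\<close>

abbreviation (input) affine_point :: "'n::finite option monomial \<Rightarrow> real ^ 'n" where
  "affine_point a \<equiv> lattice_point (dehomogenize a)"

lemma affine_point_nth: "affine_point a $ i = real (Poly_Mapping.lookup a (Some i))"
  by (simp add: lattice_point_def dehomogenize_def map_key.rep_eq)

lemma affine_point_add: "affine_point (a + b) = affine_point a + affine_point b"
  by (simp add: vec_eq_iff affine_point_nth lookup_add)

lemma affine_point_0: "affine_point 0 = 0"
  by (simp add: vec_eq_iff affine_point_nth)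

lemma affine_point_image_plus: "affine_point ` (E + F) = affine_point ` E + affine_point ` F"
  unfolding set_plus_image by (force simp: image_iff affine_point_add)

lemma affine_point_image_sum: "affine_point ` (\<Sum>i\<in>I. E i) = (\<Sum>i\<in>I. affine_point ` E i)"
  by (induction I rule: infinite_finite_induct) (simp_all add: affine_point_image_plus affine_point_0)

text \<open>Dehomogenizing forgets only the exponent of x_0, and the degree restores it. Homogeneous
  sets of monomials can therefore be counted in Z^n.\<close>

lemma affine_point_inj:
  assumes "affine_point a = affine_point b" "mon_degree a = mon_degree b"
  shows "a = b"
proof (rule poly_mapping_eqI)
  have Some: "Poly_Mapping.lookup a (Some i) = Poly_Mapping.lookup b (Some i)" for i
    using arg_cong[OF assms(1), of "\<lambda>x. x $ i"] by (simp add: affine_point_nth)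
  then show "Poly_Mapping.lookup a v = Poly_Mapping.lookup b v" for v
    using assms(2) by (cases v) (simp_all add: mon_degree_option)
qed

lemma affine_point_variables:
  "affine_point ` (variables :: 'n::finite option monomial set) = insert 0 (range (\<lambda>i. axis i 1))"
proof -
  have vars: "variables = insert (Poly_Mapping.single None 1) (range (\<lambda>i :: 'n. Poly_Mapping.single (Some i) (1 :: nat)))"
    by (simp add: variables_def full_SetCompr_eq UNIV_option_conv image_image)
  have None: "affine_point (Poly_Mapping.single None 1) = (0 :: real ^ 'n)"
    by (simp add: vec_eq_iff affine_point_nth lookup_single)
  have Some: "affine_point (Poly_Mapping.single (Some i) 1) = axis i 1" for i :: 'n
    by (simp add: vec_eq_iff affine_point_nth lookup_single axis_def when_def)
  show ?thesis unfolding vars image_insert image_image None Some ..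
qed

lemma set_sum_nonempty:
  fixes S :: "'i \<Rightarrow> 'b::comm_monoid_add set"
  assumes "\<And>i. S i \<noteq> {}"
  shows "(\<Sum>i\<in>I. S i) \<noteq> {}"
proof (cases "finite I")
  case True
  obtain s where "\<And>i. s i \<in> S i"
    by (rule that[of "\<lambda>i. SOME x. x \<in> S i"]) (simp add: some_in_eq assms)
  then have "sum s I \<in> (\<Sum>i\<in>I. S i)" unfolding set_sum_alt[OF True] by blast
  then show ?thesis by blast
qed simp

lemma scaleR_image_set_plus:
  fixes A B :: "'b::real_vector set"
  shows "(*\<^sub>R) c ` (A + B) = (*\<^sub>R) c ` A + (*\<^sub>R) c ` B"
proof (intro equalityI subsetI)
  fix x assume "x \<in> (*\<^sub>R) c ` (A + B)"
  then obtain a b where "a \<in> A" "b \<in> B" "x = c *\<^sub>R a + c *\<^sub>R b"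
    by (auto elim!: set_plus_elim simp: scaleR_add_right)
  then show "x \<in> (*\<^sub>R) c ` A + (*\<^sub>R) c ` B" by (auto intro!: set_plus_intro)
next
  fix x assume "x \<in> (*\<^sub>R) c ` A + (*\<^sub>R) c ` B"
  then obtain a b where "a \<in> A" "b \<in> B" "x = c *\<^sub>R (a + b)"
    by (auto elim!: set_plus_elim simp: scaleR_add_right)
  then show "x \<in> (*\<^sub>R) c ` (A + B)" by (auto intro!: set_plus_intro)
qed

lemma homogeneous_plus:
  assumes "\<exists>d. \<forall>a\<in>E. mon_degree a = d" "\<exists>d. \<forall>a\<in>F. mon_degree a = d"
  shows "\<exists>d. \<forall>a\<in>E + F. mon_degree a = d"
proof -
  obtain d d' where "\<And>a. a \<in> E \<Longrightarrow> mon_degree a = d" "\<And>a. a \<in> F \<Longrightarrow> mon_degree a = d'"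
    using assms by blast
  then show ?thesis by (intro exI[of _ "d + d'"]) (auto elim!: set_plus_elim simp: mon_degree_add)
qed

lemma homogeneous_sum:
  assumes "\<And>i. i \<in> I \<Longrightarrow> \<exists>d. \<forall>a\<in>E i. mon_degree a = d"
  shows "\<exists>d. \<forall>a\<in>(\<Sum>i\<in>I. E i). mon_degree a = d"
  using assms
proof (induction I rule: infinite_finite_induct)
  case (insert i I)
  then show ?case unfolding sum.insert[OF insert.hyps] by (intro homogeneous_plus) auto
qed auto

lemma finite_variables: "finite (variables :: 'v::finite monomial set)"
  by (simp add: variables_def full_SetCompr_eq)

context
  fixes M :: "'n::finite \<Rightarrow> 'n option monomial set"
  assumes fin: "\<And>i. finite (M i)" and ne: "\<And>i. M i \<noteq> {}"
    and hom: "\<And>i. \<exists>d. \<forall>a\<in>M i. mon_degree a = d"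
begin

definition affine_points :: "'n option \<Rightarrow> (real ^ 'n) set" where
  "affine_points v = affine_point ` (case v of None \<Rightarrow> variables | Some i \<Rightarrow> M i)"

definition sumset :: "('n option \<Rightarrow> nat) \<Rightarrow> (real ^ 'n) set" where
  "sumset u = (\<Sum>v\<in>UNIV. \<Sum>j<u v. affine_points v)"

lemma finite_affine_points: "finite (affine_points v)"
  by (simp add: affine_points_def fin finite_variables split: option.split)

lemma affine_points_nonempty: "affine_points v \<noteq> {}"
  by (auto simp: affine_points_def ne variables_def split: option.split)

lemma sumset_eq_image: "sumset u = affine_point ` exponent_sumset M u"
  by (simp only: sumset_def exponent_sumset_def affine_points_def affine_point_image_sum)

lemma finite_exponent_sumset: "finite (exponent_sumset M u)"
  unfolding exponent_sumset_def
  by (intro finite_set_sum ballI) (auto simp: fin finite_variables split: option.split)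

lemma homogeneous_exponent_sumset: "\<exists>d. \<forall>a\<in>exponent_sumset M u. mon_degree a = d"
  unfolding exponent_sumset_def
  by (intro homogeneous_sum) (auto simp: hom mon_degree_variable split: option.split)

lemma finite_sumset: "finite (sumset u)"
  by (simp add: sumset_eq_image finite_exponent_sumset)

lemma sumset_nonempty: "sumset u \<noteq> {}"
  by (simp add: sumset_def set_sum_nonempty affine_points_nonempty)

lemma sumset_integer_vectors: "sumset u \<subseteq> integer_vectors"
  by (auto simp: sumset_eq_image affine_point_nth)

lemma card_sumset: "card (sumset u) = card (exponent_sumset M u)"
proof -
  have "inj_on affine_point (exponent_sumset M u)"
    using homogeneous_exponent_sumset[of u] by (auto intro!: inj_onI affine_point_inj)
  then show ?thesis by (simp add: sumset_eq_image card_image)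
qed

lemma sumset_plus: "sumset (\<lambda>v. u v + w v) = sumset u + sumset w"
  by (simp only: sumset_def sum_copies_plus sum.distrib)

lemma sumset_mult: "sumset (\<lambda>v. t * u v) = (\<Sum>j<t. sumset u)"
proof (induction t)
  case 0
  show ?case by (simp add: sumset_def del: set_zero)
next
  case (Suc t)
  then show ?case by (simp add: sumset_plus add.commute)
qed

text \<open>One copy of the simplex of variables is split off from the sum and added to any point of
  the remaining sumset. This provides the base point for
  \<open>tendsto_card_sum_copies\<close>.\<close>

lemma sumset_contains_simplex:
  assumes "u None \<ge> 1"
  shows "\<exists>b\<in>sumset u. \<forall>i. b + axis i 1 \<in> sumset u"
proof -
  define w where "w = u(None := u None - 1)"
  obtain b where b: "b \<in> sumset w" using sumset_nonempty by blast
  have "u = (\<lambda>v. w v + (if v = None then 1 else 0))" using assms by (auto simp: w_def)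
  moreover have "sumset (\<lambda>v. if v = None then 1 else 0) = affine_points None"
    by (simp add: sumset_def UNIV_option_conv sum.reindex del: set_zero)
  ultimately have *: "sumset u = sumset w + affine_points None" using sumset_plus by metis
  have "b + x \<in> sumset u" if "x \<in> insert 0 (range (\<lambda>i. axis i 1))" for x
    unfolding * using b that by (auto simp: affine_points_def affine_point_variables intro!: set_plus_intro)
  from this[of 0] this show ?thesis by auto
qed

lemma mixed_length_eq:
  fixes J :: "'n \<Rightarrow> ('n option, 'k::field) mpoly set"
  assumes "\<And>i. J i = ideal_gen (poly_of_monomial ` M i)"
  shows "mixed_length max_graded_ideal J u = enat (card (sumset u))"
proof -
  obtain d where "\<And>a. a \<in> exponent_sumset M u \<Longrightarrow> mon_degree a = d"
    using homogeneous_exponent_sumset by blast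
  from quotient_length_monomial_ideals[OF finite_exponent_sumset this] show ?thesis
    unfolding mixed_length_def ideal_power_product_eq[OF assms] exponent_sumset_Suc card_sumset .
qed

text \<open>Existence from the growth of sumsets and uniqueness from \<open>mpoly_eqI_large\<close>
  resolve the \<open>THE\<close>; from here on only this equation at large \<open>u\<close> is
  used.\<close>

lemma mixed_hilbert_poly_eval:
  fixes J :: "'n \<Rightarrow> ('n option, 'k::field) mpoly set"
  assumes J: "\<And>i. J i = ideal_gen (poly_of_monomial ` M i)"
  shows "\<exists>N. \<forall>u. (\<forall>v. N \<le> u v) \<longrightarrow>
    real (card (sumset u)) = mpoly_eval (mixed_hilbert_poly max_graded_ideal J) (\<lambda>v. real (u v))"
proof -
  have "eventually_poly (\<lambda>u. real (card (sumset u)))"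
    unfolding sumset_def by (intro card_sumset_eventually_poly finite_affine_points affine_points_nonempty)
  then obtain p N where p: "p \<in> polyfuns" "\<And>u. \<forall>v. N \<le> u v \<Longrightarrow> real (card (sumset u)) = p (\<lambda>v. real (u v))"
    unfolding eventually_poly_def by blast
  obtain P where "\<And>x. p x = mpoly_eval P x" using polyfun_is_mpoly[OF p(1)] by blast
  then have P: "real (card (sumset u)) = mpoly_eval P (\<lambda>v. real (u v))" if "\<forall>v. N \<le> u v" for u
    using p(2)[OF that] by simp
  have "mixed_hilbert_poly max_graded_ideal J = P"
    unfolding mixed_hilbert_poly_def mixed_length_eq[OF J]
  proof (rule the_equality)
    show "\<exists>N. \<forall>u. (\<forall>v. N \<le> u v) \<longrightarrow> ereal_of_enat (enat (card (sumset u))) = ereal (mpoly_eval P (\<lambda>v. real (u v)))"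
      using P by auto
    fix P' assume "\<exists>N. \<forall>u. (\<forall>v. N \<le> u v) \<longrightarrow>
      ereal_of_enat (enat (card (sumset u))) = ereal (mpoly_eval P' (\<lambda>v. real (u v)))"
    then obtain N' where P': "\<And>u. \<forall>v. N' \<le> u v \<Longrightarrow> real (card (sumset u)) = mpoly_eval P' (\<lambda>v. real (u v))"
      by auto
    show "P' = P"
    proof (rule mpoly_eqI_large[of "max N N'"])
      fix u :: "'n option \<Rightarrow> nat" assume "\<And>v. max N N' \<le> u v"
      then show "mpoly_eval P' (\<lambda>v. real (u v)) = mpoly_eval P (\<lambda>v. real (u v))"
        using P[of u] P'[of u] by simp
    qed
  qed
  with P show ?thesis by blast
qed

text \<open>Since all entries of \<open>u\<close> are at least 1, the points \<open>t u\<close> with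
  t \<ge> N lie where P counts, and the sumset there is the t-fold sum of \<open>sumset u\<close>.
  The volume law thus gives the limit of P(t u) / t^n.\<close>

lemma homogeneous_part_eq_volume:
  assumes P: "\<And>u. (\<forall>v. N \<le> u v) \<Longrightarrow> real (card (sumset u)) = mpoly_eval P (\<lambda>v. real (u v))"
    and u: "\<And>v. 1 \<le> u v"
  shows "homogeneous_part CARD('n) P (\<lambda>v. real (u v)) = measure lebesgue (convex hull (sumset u))"
proof (rule homogeneous_part_eq_limit)
  obtain b where "b \<in> sumset u" "\<And>i. b + axis i 1 \<in> sumset u" using sumset_contains_simplex[of u] u by blast
  from tendsto_card_sum_copies[OF finite_sumset sumset_integer_vectors this]
  have lim: "(\<lambda>t. real (card (sumset (\<lambda>v. t * u v))) / real t ^ CARD('n)) \<longlonglongrightarrow> measure lebesgue (convex hull (sumset u))"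
    by (simp only: sumset_mult)
  have "\<forall>\<^sub>F t in sequentially. real (card (sumset (\<lambda>v. t * u v))) / real t ^ CARD('n)
      = mpoly_eval P (\<lambda>v. real t * real (u v)) / real t ^ CARD('n)"
    using eventually_ge_at_top[of N]
  proof eventually_elim
    case (elim t)
    have "N \<le> t * u v" for v using mult_le_mono[OF elim u[of v]] by simp
    then show ?case using P[of "\<lambda>v. t * u v"] by simp
  qed
  from tendsto_cong[THEN iffD1, OF this lim]
  show "(\<lambda>t. mpoly_eval P (\<lambda>v. real t * real (u v)) / real t ^ CARD('n))
    \<longlonglongrightarrow> measure lebesgue (convex hull (sumset u))" .
qed

text \<open>
  The volume formula holds only where all entries of \<open>u\<close> are positive, so the value at
  \<open>(0, 1_H)\<close> is reached as the limit of \<open>(1, \<dots>, 1) / s + (0, 1_H)\<close>.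
\<close>

lemma homogeneous_part_eq_volume_face:
  assumes P: "\<And>u. (\<forall>v. N \<le> u v) \<Longrightarrow> real (card (sumset u)) = mpoly_eval P (\<lambda>v. real (u v))"
  shows "homogeneous_part CARD('n) P (\<lambda>v. case v of None \<Rightarrow> 0 | Some i \<Rightarrow> if i \<in> H then 1 else 0)
    = measure lebesgue (\<Sum>i\<in>H. convex hull (affine_point ` M i))"
proof -
  define e :: "'n option \<Rightarrow> nat" where "e = (\<lambda>v. case v of None \<Rightarrow> 0 | Some i \<Rightarrow> if i \<in> H then 1 else 0)"
  let ?K = "\<Sum>i\<in>H. convex hull (affine_point ` M i)"
  let ?L = "convex hull (sumset (\<lambda>_. 1))"
  have e_sumset: "sumset e = (\<Sum>i\<in>H. affine_point ` M i)"
  proof -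
    have "sumset e = (\<Sum>i\<in>UNIV. \<Sum>j<(if i \<in> H then 1 else 0 :: nat). affine_point ` M i)"
      by (simp add: sumset_def e_def UNIV_option_conv sum.reindex affine_points_def)
    also have "\<dots> = (\<Sum>i\<in>UNIV. if i \<in> H then affine_point ` M i else 0)"
      by (rule sum.cong) auto
    finally show ?thesis by (simp add: sum.If_cases del: set_zero)
  qed
  have K: "?K = convex hull (sumset e)" by (simp only: e_sumset convex_hull_set_sum)
  have K_compact: "compact ?K" unfolding K by (intro finite_imp_compact_convex_hull finite_sumset)
  have L: "compact ?L" "?L \<noteq> {}" using sumset_nonempty by (auto intro: finite_imp_compact_convex_hull finite_sumset)
  have scaled: "homogeneous_part CARD('n) P (\<lambda>v. 1 / real s + real (e v)) = measure lebesgue (?K + (*\<^sub>R) (1 / real s) ` ?L)"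
    if s: "0 < s" for s
  proof -
    \<comment> \<open>1 / s + e is the positive integer point 1 + s e divided by s. Homogeneity of
      degree n turns this division into a scaling of the convex hull by 1 / s.\<close>
    have "homogeneous_part CARD('n) P (\<lambda>v. 1 / real s + real (e v))
        = homogeneous_part CARD('n) P (\<lambda>v. (1 / real s) * real (1 + s * e v))"
      using s by (simp add: field_simps)
    also have "\<dots> = (1 / real s) ^ CARD('n) * measure lebesgue (convex hull (sumset (\<lambda>v. 1 + s * e v)))"
      unfolding homogeneous_part_scale by (subst homogeneous_part_eq_volume[OF P]) auto
    also have "\<dots> = measure lebesgue ((*\<^sub>R) (1 / real s) ` (convex hull (sumset (\<lambda>v. 1 + s * e v))))"
      by (simp add: measure_scaleR)
    also have "convex hull (sumset (\<lambda>v. 1 + s * e v)) = ?L + (*\<^sub>R) (real s) ` ?K"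
    proof -
      have "convex hull (sumset (\<lambda>v. 1 + s * e v)) = ?L + (\<Sum>j<s. convex hull (sumset e))"
        by (simp only: sumset_plus sumset_mult convex_hull_set_plus convex_hull_set_sum)
      then show ?thesis unfolding K using sumset_nonempty by (simp add: sum_copies_convex)
    qed
    also have "(*\<^sub>R) (1 / real s) ` (?L + (*\<^sub>R) (real s) ` ?K) = ?K + (*\<^sub>R) (1 / real s) ` ?L"
    proof -
      have "(*\<^sub>R) (1 / real s) ` (?L + (*\<^sub>R) (real s) ` ?K)
          = (*\<^sub>R) (1 / real s) ` ?L + (*\<^sub>R) (1 / real s) ` (*\<^sub>R) (real s) ` ?K"
        by (rule scaleR_image_set_plus)
      also have "(*\<^sub>R) (1 / real s) ` (*\<^sub>R) (real s) ` ?K = ?K" using s by (simp add: image_image)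
      finally show ?thesis by (simp add: add.commute)
    qed
    finally show ?thesis .
  qed
  have "(\<lambda>s. homogeneous_part CARD('n) P (\<lambda>v. 1 / real s + real (e v)))
      \<longlonglongrightarrow> homogeneous_part CARD('n) P (\<lambda>v. 0 + real (e v))"
    by (intro tendsto_homogeneous_part tendsto_intros lim_1_over_n)
  moreover have "(\<lambda>s. homogeneous_part CARD('n) P (\<lambda>v. 1 / real s + real (e v))) \<longlonglongrightarrow> measure lebesgue ?K"
  proof (rule tendsto_cong[THEN iffD1, OF _ tendsto_measure_plus_small[OF K_compact L]])
    show "\<forall>\<^sub>F s in sequentially. measure lebesgue (?K + (*\<^sub>R) (1 / real s) ` ?L)
        = homogeneous_part CARD('n) P (\<lambda>v. 1 / real s + real (e v))"
      using eventually_gt_at_top[of 0] by eventually_elim (rule scaled[symmetric])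
  qed
  ultimately have "homogeneous_part CARD('n) P (\<lambda>v. 0 + real (e v)) = measure lebesgue ?K"
    by (rule LIMSEQ_unique)
  moreover have "(\<lambda>v. 0 + real (e v)) = (\<lambda>v. case v of None \<Rightarrow> 0 | Some i \<Rightarrow> if i \<in> H then 1 else 0)"
    by (auto simp: e_def split: option.split)
  ultimately show ?thesis by simp
qed

end

lemma mixed_volume_eq_sum_subsets:
  fixes Q :: "'n::finite \<Rightarrow> (real ^ 'n) set"
  shows "mixed_volume Q = (\<Sum>H\<in>UNIV. (-1) ^ (CARD('n) - card H) * measure lebesgue (\<Sum>i\<in>H. Q i))"
proof -
  let ?g = "\<lambda>H. (-1) ^ (CARD('n) - card H) * measure lebesgue (\<Sum>i\<in>H. Q i)"
  have "(\<Sum>H\<in>UNIV. ?g H) = (\<Sum>h\<in>{0..CARD('n)}. \<Sum>H | H \<in> UNIV \<and> card H = h. ?g H)"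
    by (rule sum.group[symmetric]) (simp_all add: image_subset_iff card_mono)
  also have "\<dots> = (\<Sum>H | H \<in> UNIV \<and> card H = 0. ?g H) + (\<Sum>h = 1..CARD('n). \<Sum>H | H \<in> UNIV \<and> card H = h. ?g H)"
    by (subst sum.atLeast_Suc_atMost) auto
  \<comment> \<open>The empty Minkowski sum is {0}, a null set, so admitting the empty H changes
    nothing.\<close>
  also have "(\<Sum>H | H \<in> UNIV \<and> card H = 0. ?g H) = 0" by simp
  also have "(\<Sum>h = 1..CARD('n). \<Sum>H | H \<in> UNIV \<and> card H = h. ?g H)
      = (\<Sum>h = 1..CARD('n). \<Sum>H | card H = h. (-1) ^ (CARD('n) - h) * measure lebesgue (\<Sum>i\<in>H. Q i))"
    by (intro sum.cong) auto
  finally show ?thesis by (simp add: mixed_volume_def)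
qed

theorem corollary2p5:
  fixes Q :: "'n::finite \<Rightarrow> (real ^ 'n) set"
    and M :: "'n \<Rightarrow> 'n option monomial set"
    and J :: "'n \<Rightarrow> ('n option, 'k::field) mpoly set"
  assumes "\<And>i. lattice_polytope (Q i)"
    and "\<And>i. finite (M i)"
    and "\<And>i. \<exists>d. \<forall>a\<in>M i. mon_degree a = d"
    and "\<And>i. Q i = convex hull ((\<lambda>a. lattice_point (dehomogenize a)) ` M i)"
    and "\<And>i. J i = ideal_gen (poly_of_monomial ` M i)"
  shows "mixed_volume Q =
    mixed_multiplicity (\<lambda>v. case v of None \<Rightarrow> 0 | Some i \<Rightarrow> 1) max_graded_ideal J"
proof -
  \<comment> \<open>Lattice polytopes are nonempty by definition, which rules out zero ideals
    \<open>J i\<close>.\<close>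
  have ne: "M i \<noteq> {}" for i
  proof -
    have "Q i \<noteq> {}" using assms(1)[of i] unfolding lattice_polytope_def by (metis convex_hull_eq_empty)
    then show ?thesis using assms(4)[of i] by auto
  qed
  let ?P = "mixed_hilbert_poly max_graded_ideal J"
  have "\<exists>N. \<forall>u. (\<forall>v. N \<le> u v) \<longrightarrow> real (card (sumset M u)) = mpoly_eval ?P (\<lambda>v. real (u v))"
    by (rule mixed_hilbert_poly_eval[OF assms(2) ne assms(3) assms(5)])
  then obtain N where N: "\<And>u. (\<forall>v. N \<le> u v) \<Longrightarrow> real (card (sumset M u)) = mpoly_eval ?P (\<lambda>v. real (u v))"
    by blast
  have "mixed_volume Q = (\<Sum>H\<in>UNIV. (-1) ^ (CARD('n) - card H) * homogeneous_part CARD('n) ?P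
      (\<lambda>v. case v of None \<Rightarrow> 0 | Some i \<Rightarrow> if i \<in> H then 1 else 0))"
    unfolding mixed_volume_eq_sum_subsets assms(4)
    by (simp only: homogeneous_part_eq_volume_face[OF assms(2) ne assms(3) N])
  also have "\<dots> = Poly_Mapping.lookup ?P (Abs_poly_mapping (\<lambda>v. case v of None \<Rightarrow> 0 | Some i \<Rightarrow> 1))"
    by (rule alternating_sum_homogeneous_part)
  \<comment> \<open>All entries of the exponent are 0 or 1, so the factorials are 1 and the
    multiplicity is the coefficient itself.\<close>
  also have "\<dots> = mixed_multiplicity (\<lambda>v. case v of None \<Rightarrow> 0 | Some i \<Rightarrow> 1) max_graded_ideal J"
    by (simp add: mixed_multiplicity_def UNIV_option_conv prod.reindex)
  finally show ?thesis .
qed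

end
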